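(* Consider the bicolor Wang tilesets $T_1=\{0000,1010,0101,0110\}$, $T_2=\{0000,1010,0110,0011\}$, $T_3=\{0000,1010,0101,1111,0110\}$, $T_4=\{0000,1010,0101,0110,0011\}$, $T_5=\{0000,1111,1100,0110,0011\}$, $T_6=\{0000,1010,0101,1111,0110,0011\}$, $T_7=\{0000,1111,0110,0011\}$. For each $k\in\{1,\ldots,6\}$, the induced $\mathbb{Z}^2$-subshift $X_{T_k}$ is weakly mixing and $\overline{\mathbb{Z}}$ is a weak factor of $X_{T_k}$; therefore $X_{T_k}\notin\mathcal{L}^1$. Moreover, $X_{T_7}\notin\mathcal{L}^1$.
   Context: **Tilesets.** A bicolor Wang tile assigns to each edge of the unit square a color, $0$ (white) or $1$ (black). It is written as a word of four bits giving the colors of its left, upper, right and lower edges, in this order. A tileset $T$ induces the subshift $X_T\subseteq T^{\mathbb{Z}^2}$ of configurations $x$ such that the right edge of $x(i,j)$ has the same color as the left edge of $x(i+1,j)$ and the upper edge of $x(i,j)$ has the same color as the lower edge of $x(i,j+1)$, for all $i,j$. **Subshifts.** For a finite alphabet $\Sigma$, $\Sigma^{\mathbb{Z}^d}$ has the product topology and the shift action $(p\cdot x)(q)=x(p+q)$. A $\mathbb{Z}^d$-subshift is a closed shift-invariant subset. A pattern $\pi\in\Sigma^F$ ($F\subseteq\mathbb{Z}^d$) is valid relative to $X$ if some shift of an element of $X$ extends it. Disjoint regions $F,G$ are independent if $\pi\cup\pi'$ is valid for all valid $F$-patterns $\pi$ and valid $G$-patterns $\pi'$. $X$ is transitive if any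 two valid finite patterns appear in a common element of $X$. $X$ is weakly mixing if $X\times X$ is transitive; equivalently, if for every $n\in\mathbb{N}$ there is $p\in\mathbb{Z}^d$ such that $Q_n=[-n,n]^d$ and $p+Q_n$ are independent. **Weak factor.** A $\mathbb{Z}^e$-subshift $Y$ is a weak factor of a $\mathbb{Z}^d$-subshift $X$ if there are a continuous surjective map $f:X\to Y$ and a group homomorphism $\varphi:\mathbb{Z}^e\to\mathbb{Z}^d$ such that $p\cdot f(x)=f(\varphi(p)\cdot x)$ for all $p\in\mathbb{Z}^e$, $x\in X$. **The subshift $\overline{\mathbb{Z}}$.** It is the $\mathbb{Z}$-subshift on the alphabet $\{\text{white},\text{black}\}$ consisting of all bi-infinite sequences in which a black symbol is never immediately followed (on its right) by a white symbol. **Class $\mathcal{L}^1$.** Let $A,B$ be finite and $E,F$ countable. For a continuous $f:A^E\to B^F$ and $q\in F$, $\mathcal{W}_f(q)\subseteq E$ is the minimal region on which the values of any $x\in A^E$ determine the value of $f(x)$ at $q$. $f$ is $r$-narrow if $|\mathcal{W}_f(q)|\le r$ for all $q\in F$. A compact set $X\subseteq\Sigma^F$ ($\Sigma$ finite, $F$ countable) belongs to $\mathcal{L}^1$ if $X=\bigcup_{n\in\mathbb{N}}X_n$ where $X_n=\mathrm{im}(f_n)$ for some $r_n$-narrow function $f_n:A_n^{\mathbb{N}}\to X$, with $A_n$ a finite alphabet and $r_n\in\mathbb{N}$. *)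

theory Defs
  imports "HOL-Analysis.Analysis" "HOL-Library.Z2"
begin

section \<open>Configurations and subshifts\<close>

text \<open>\<open>conf_space A I\<close> is the space \<open>A\<^sup>I\<close>; its points are the elements of \<open>I \<rightarrow>\<^sub>E A\<close>.\<close>

definition conf_space :: "'a set \<Rightarrow> 'i set \<Rightarrow> ('i \<Rightarrow> 'a) topology" where
  "conf_space A I = product_topology (\<lambda>_. discrete_topology A) I"

text \<open>The acting group is an arbitrary abelian group here; it is used with \<open>int\<close> and
  \<open>int \<times> int\<close> (componentwise addition) for \<open>\<int>\<close> and \<open>\<int>\<^sup>2\<close>.\<close>

definition shift :: "'g::ab_group_add \<Rightarrow> ('g \<Rightarrow> 'a) \<Rightarrow> ('g \<Rightarrow> 'a)" where
  "shift p x = (\<lambda>q. x (p + q))"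

definition subshift :: "'a set \<Rightarrow> ('g::ab_group_add \<Rightarrow> 'a) set \<Rightarrow> bool" where
  "subshift A X \<longleftrightarrow>
     finite A \<and> closedin (conf_space A UNIV) X \<and> (\<forall>p. \<forall>x\<in>X. shift p x \<in> X)"

text \<open>A pattern on \<open>F\<close> is given by a total function of which only the values on \<open>F\<close> matter.
  It appears in \<open>x\<close> if some shift of \<open>x\<close> extends it.\<close>

definition appears_in :: "'g::ab_group_add set \<Rightarrow> ('g \<Rightarrow> 'a) \<Rightarrow> ('g \<Rightarrow> 'a) \<Rightarrow> bool" where
  "appears_in F \<pi> x \<longleftrightarrow> (\<exists>p. \<forall>q\<in>F. shift p x q = \<pi> q)"

definition valid_pattern :: "('g::ab_group_add \<Rightarrow> 'a) set \<Rightarrow> 'g set \<Rightarrow> ('g \<Rightarrow> 'a) \<Rightarrow> bool" where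
  "valid_pattern X F \<pi> \<longleftrightarrow> (\<exists>x\<in>X. appears_in F \<pi> x)"

definition transitive_shift :: "('g::ab_group_add \<Rightarrow> 'a) set \<Rightarrow> bool" where
  "transitive_shift X \<longleftrightarrow>
     (\<forall>F \<pi> G \<rho>. finite F \<longrightarrow> finite G \<longrightarrow> valid_pattern X F \<pi> \<longrightarrow> valid_pattern X G \<rho> \<longrightarrow>
        (\<exists>x\<in>X. appears_in F \<pi> x \<and> appears_in G \<rho> x))"

text \<open>The product of two subshifts, as a subshift on the product alphabet.\<close>

definition product_shift :: "('g \<Rightarrow> 'a) set \<Rightarrow> ('g \<Rightarrow> 'b) set \<Rightarrow> ('g \<Rightarrow> 'a \<times> 'b) set" where
  "product_shift X Y = {(\<lambda>p. (x p, y p)) | x y. x \<in> X \<and> y \<in> Y}"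

definition weakly_mixing :: "('g::ab_group_add \<Rightarrow> 'a) set \<Rightarrow> bool" where
  "weakly_mixing X \<longleftrightarrow> transitive_shift (product_shift X X)"

text \<open>\<open>weak_factor B Y A X\<close>: the subshift \<open>Y\<close> (alphabet \<open>B\<close>) is a weak factor of the
  subshift \<open>X\<close> (alphabet \<open>A\<close>).\<close>

definition weak_factor ::
    "'b set \<Rightarrow> ('h::ab_group_add \<Rightarrow> 'b) set \<Rightarrow> 'a set \<Rightarrow> ('g::ab_group_add \<Rightarrow> 'a) set \<Rightarrow> bool" where
  "weak_factor B Y A X \<longleftrightarrow> subshift B Y \<and> subshift A X \<and>
     (\<exists>f \<phi>. continuous_map (subtopology (conf_space A UNIV) X)
                            (subtopology (conf_space B UNIV) Y) f \<and>
            f ` X = Y \<and> Modules.additive \<phi> \<and>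
            (\<forall>p. \<forall>x\<in>X. shift p (f x) = f (shift (\<phi> p) x)))"


section \<open>The class \<open>\<L>\<^sup>1\<close>\<close>

definition determines ::
    "'a set \<Rightarrow> 'e set \<Rightarrow> (('e \<Rightarrow> 'a) \<Rightarrow> ('i \<Rightarrow> 'b)) \<Rightarrow> 'i \<Rightarrow> 'e set \<Rightarrow> bool" where
  "determines A E f q W \<longleftrightarrow>
     (\<forall>x\<in>E \<rightarrow>\<^sub>E A. \<forall>y\<in>E \<rightarrow>\<^sub>E A. (\<forall>e\<in>W. x e = y e) \<longrightarrow> f x q = f y q)"

text \<open>The least element is taken with respect to inclusion. For continuous \<open>f\<close> and finite \<open>A\<close> it
  exists: determining regions are closed under binary intersection, and one of them is finite by
  compactness.\<close>

definition window :: "'a set \<Rightarrow> 'e set \<Rightarrow> (('e \<Rightarrow> 'a) \<Rightarrow> ('i \<Rightarrow> 'b)) \<Rightarrow> 'i \<Rightarrow> 'e set" where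
  "window A E f q = (LEAST W. W \<subseteq> E \<and> determines A E f q W)"

definition narrow :: "'a set \<Rightarrow> 'e set \<Rightarrow> 'i set \<Rightarrow> nat \<Rightarrow> (('e \<Rightarrow> 'a) \<Rightarrow> ('i \<Rightarrow> 'b)) \<Rightarrow> bool" where
  "narrow A E F r f \<longleftrightarrow> (\<forall>q\<in>F. finite (window A E f q) \<and> card (window A E f q) \<le> r)"

text \<open>The members of \<open>\<L>\<^sup>1\<close> that are subsets of \<open>S\<^sup>F\<close> (for \<open>S\<close> finite and \<open>F\<close> countable). Up to
  renaming of symbols, every finite alphabet is a finite set of natural numbers.\<close>

definition class_L1 :: "'a set \<Rightarrow> 'i set \<Rightarrow> ('i \<Rightarrow> 'a) set set" where
  "class_L1 S F = {X. compactin (conf_space S F) X \<and>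
     (\<exists>(A :: nat \<Rightarrow> nat set) (r :: nat \<Rightarrow> nat) (f :: nat \<Rightarrow> (nat \<Rightarrow> nat) \<Rightarrow> ('i \<Rightarrow> 'a)).
        (\<forall>n. finite (A n) \<and>
             continuous_map (conf_space (A n) UNIV) (subtopology (conf_space S F) X) (f n) \<and>
             narrow (A n) UNIV F (r n) (f n)) \<and>
        X = (\<Union>n. f n ` (UNIV \<rightarrow>\<^sub>E A n)))}"


section \<open>Wang tiles\<close>

text \<open>Colors are bits: \<open>0\<close> is white and \<open>1\<close> is black.\<close>

datatype tile =
  Tile (left_edge: bit) (upper_edge: bit) (right_edge: bit) (lower_edge: bit)

definition wang_shift :: "tile set \<Rightarrow> (int \<times> int \<Rightarrow> tile) set" where
  "wang_shift T = {x. (\<forall>p. x p \<in> T) \<and>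
     (\<forall>i j. right_edge (x (i, j)) = left_edge (x (i + 1, j)) \<and>
            upper_edge (x (i, j)) = lower_edge (x (i, j + 1)))}"

definition Zbar :: "(int \<Rightarrow> bit) set" where
  "Zbar = {y. \<forall>n. \<not> (y n = 1 \<and> y (n + 1) = 0)}"

definition "T\<^sub>1 = {Tile 0 0 0 0, Tile 1 0 1 0, Tile 0 1 0 1, Tile 0 1 1 0}"
definition "T\<^sub>2 = {Tile 0 0 0 0, Tile 1 0 1 0, Tile 0 1 1 0, Tile 0 0 1 1}"
definition "T\<^sub>3 = {Tile 0 0 0 0, Tile 1 0 1 0, Tile 0 1 0 1, Tile 1 1 1 1, Tile 0 1 1 0}"
definition "T\<^sub>4 = {Tile 0 0 0 0, Tile 1 0 1 0, Tile 0 1 0 1, Tile 0 1 1 0, Tile 0 0 1 1}"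
definition "T\<^sub>5 = {Tile 0 0 0 0, Tile 1 1 1 1, Tile 1 1 0 0, Tile 0 1 1 0, Tile 0 0 1 1}"
definition "T\<^sub>6 = {Tile 0 0 0 0, Tile 1 0 1 0, Tile 0 1 0 1, Tile 1 1 1 1, Tile 0 1 1 0, Tile 0 0 1 1}"
definition "T\<^sub>7 = {Tile 0 0 0 0, Tile 1 1 1 1, Tile 0 1 1 0, Tile 0 0 1 1}"


section \<open>The sets in question are subshifts\<close>

lemma continuous_map_conf_coord:
  assumes "i \<in> I"
  shows "continuous_map (conf_space A I) (discrete_topology UNIV) (\<lambda>x. h (x i))"
proof -
  have "continuous_map (conf_space A I) (discrete_topology A) (\<lambda>x. x i)"
    unfolding conf_space_def by (rule continuous_map_product_projection[OF assms])
  moreover have "continuous_map (discrete_topology A) (discrete_topology UNIV) h"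
    by simp
  ultimately show ?thesis
    using continuous_map_compose[unfolded o_def] by blast
qed

lemma closedin_conf_eq:
  assumes "i \<in> I" "j \<in> I"
  shows "closedin (conf_space A I) {x \<in> I \<rightarrow>\<^sub>E A. g (x i) = h (x j)}"
  using closedin_continuous_maps_eq[OF _ continuous_map_conf_coord[OF assms(1), of A g]
      continuous_map_conf_coord[OF assms(2), of A h]]
  by (simp add: conf_space_def)

lemma subshift_wang_shift:
  assumes "finite T"
  shows "subshift T (wang_shift T)"
proof -
  have eq: "wang_shift T =
    (\<Inter>(i, j)\<in>UNIV. {x \<in> UNIV \<rightarrow>\<^sub>E T. right_edge (x (i, j)) = left_edge (x (i + 1, j))} \<inter>
                {x \<in> UNIV \<rightarrow>\<^sub>E T. upper_edge (x (i, j)) = lower_edge (x (i, j + 1))})"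
    by (fastforce simp: wang_shift_def)
  have "closedin (conf_space T UNIV) (wang_shift T)"
    unfolding eq by (intro closedin_INT) (auto intro!: closedin_Int closedin_conf_eq)
  moreover have "shift p x \<in> wang_shift T" if "x \<in> wang_shift T" for p x
    using that by (cases p) (simp add: wang_shift_def shift_def add.assoc[symmetric])
  ultimately show ?thesis
    using assms by (simp add: subshift_def)
qed

lemma compactin_subshift:
  fixes X :: "('g::ab_group_add \<Rightarrow> 'a) set"
  assumes "subshift A X"
  shows "compactin (conf_space A UNIV) X"
proof -
  have "compact_space (conf_space A (UNIV :: 'g set))"
    using assms by (auto simp: conf_space_def subshift_def compact_space_product_topology
        compact_space_discrete_topology)
  then show ?thesis
    using assms closedin_compact_space by (auto simp: subshift_def)
qed

lemma subshift_Zbar: "subshift UNIV Zbar"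
proof -
  have eq: "Zbar = (\<Inter>n. {y \<in> UNIV \<rightarrow>\<^sub>E UNIV. y n = 0} \<union> {y \<in> UNIV \<rightarrow>\<^sub>E UNIV. y (n + 1) = 1})"
    by (auto simp: Zbar_def)
  have "closedin (conf_space UNIV UNIV) {y \<in> UNIV \<rightarrow>\<^sub>E UNIV. y n = c}" for n :: int and c :: bit
    using closedin_conf_eq[of n UNIV n UNIV "\<lambda>b. b" "\<lambda>_. c"] by simp
  then have "closedin (conf_space UNIV UNIV) Zbar"
    unfolding eq by (intro closedin_INT closedin_Un) auto
  moreover have "finite (UNIV :: bit set)"
    by (rule finite_subset[of _ "{0, 1}"]) auto
  ultimately show ?thesis
    by (auto simp: subshift_def Zbar_def shift_def add.assoc[symmetric])
qed

end

theory Submission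
  imports Defs
begin

text \<open>
  \<^bold>\<open>Leaving the class.\<close> Suppose that a compact set \<open>X\<close> is a countable union of images of narrow
  functions. By the Baire category theorem one of these images, say of an \<open>r\<close>-narrow \<open>f\<close> on the
  alphabet \<open>A\<close>, contains a whole cylinder of \<open>X\<close>. Let \<open>P\<^sub>0, \<dots>, P\<^sub>m\<close> be properties of points of \<open>X\<close>,
  each read off from at most \<open>c\<close> cells, such that \<open>P\<^sub>k\<close> implies \<open>P\<^sub>k\<^sub>+\<^sub>1\<close> on \<open>X\<close> while some point of
  the cylinder has \<open>P\<^sub>k\<^sub>+\<^sub>1\<close> but not \<open>P\<^sub>k\<close>. Pulled back along \<open>f\<close>, they form a strictly increasing
  chain of properties of words over \<open>A\<close>, each depending on at most \<open>c * r\<close> letters. The proportion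
  of words with such a property is a multiple of \<open>card A ^ (- c * r)\<close>, so that
  \<open>m \<le> card A ^ (c * r)\<close>. Hence \<open>X\<close> is outside the class as soon as every cylinder supports
  arbitrarily long chains; this is \<open>not_class_L1_if_chains\<close>.

  \<^bold>\<open>Mixing and the factor.\<close> A configuration of \<open>Zbar\<close> switches from white to black at most
  once, so for a factor map \<open>g\<close> onto \<open>Zbar\<close> the properties ``\<open>g x\<close> is black at \<open>k\<close>'', for
  \<open>k = 0, \<dots>, m\<close>, form such a chain on \<open>X\<close>. If any two finite patterns can be placed together, at a relative position depending only on
  their shape (\<open>independent_translates\<close>), then the switch can be placed at will while a given
  cylinder is respected. The same property, applied in both coordinates with the same relative
  position, gives weak mixing.

  \<^bold>\<open>The six weakly mixing tilesets.\<close> Black edges form lines. Except in \<open>T\<^sub>5\<close>, a line running to the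
  right never stops, so each row switches from white to black at most once. In \<open>T\<^sub>5\<close> lines are staircases, and the same happens
  along the diagonal. For independence, each box is completed to a configuration that is blank
  outside an unbounded region which is disjoint from one of its translates: lines crossing the
  boundary of the box are bent by corners (\<open>T\<^sub>1\<close>, \<open>T\<^sub>3\<close>, \<open>T\<^sub>4\<close>, \<open>T\<^sub>6\<close>), or the configuration is cut
  along a row or staircase next to the box (\<open>T\<^sub>2\<close>, \<open>T\<^sub>5\<close>).

  \<^bold>\<open>The seventh tileset.\<close> Here rows still switch at most once, but the positions of the switches in
  consecutive rows are tied together: they are given by a walk with steps of size one. The walk can be
  changed arbitrarily above any given box, and far enough above it reaches arbitrarily
  many positions, which provides the chains.
\<close>

section \<open>Continuous functions depend on few coordinates\<close>

lemma open_contains_cylinder: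
  assumes "openin (conf_space A I) U" "x \<in> U"
  shows "\<exists>D. finite D \<and> D \<subseteq> I \<and> (\<forall>y\<in>I \<rightarrow>\<^sub>E A. (\<forall>q\<in>D. y q = x q) \<longrightarrow> y \<in> U)"
proof -
  obtain V where V: "finite {i \<in> I. V i \<noteq> A}" "x \<in> Pi\<^sub>E I V" "Pi\<^sub>E I V \<subseteq> U"
    using assms unfolding conf_space_def openin_product_topology_alt by force
  show ?thesis
  proof (intro exI[of _ "{i \<in> I. V i \<noteq> A}"] conjI ballI impI V(1))
    fix y assume y: "y \<in> I \<rightarrow>\<^sub>E A" "\<forall>q\<in>{i \<in> I. V i \<noteq> A}. y q = x q"
    have "y i \<in> V i" if "i \<in> I" for i
      using that y V(2) by (cases "V i = A") (auto simp: PiE_iff)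
    then have "y \<in> Pi\<^sub>E I V"
      using y(1) by (auto simp: PiE_iff)
    then show "y \<in> U"
      using V(3) by blast
  qed auto
qed

text \<open>Uniform continuity: finitely many of the cylinders on which \<open>h\<close> is constant cover the compact
  set.\<close>

lemma finite_determination:
  assumes K: "compactin (conf_space A I) K"
    and h: "continuous_map (subtopology (conf_space A I) K) (discrete_topology B) h"
  shows "\<exists>D. finite D \<and> D \<subseteq> I \<and> (\<forall>x\<in>K. \<forall>y\<in>K. (\<forall>q\<in>D. x q = y q) \<longrightarrow> h x = h y)"
proof -
  have K_sub: "K \<subseteq> I \<rightarrow>\<^sub>E A"
    using compactin_subset_topspace[OF K] by (simp add: conf_space_def)
  have "\<exists>D. finite D \<and> D \<subseteq> I \<and> (\<forall>y\<in>K. (\<forall>q\<in>D. y q = x q) \<longrightarrow> h y = h x)" if x: "x \<in> K" for x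
  proof -
    have top: "topspace (subtopology (conf_space A I) K) = K"
      using K_sub by (auto simp: conf_space_def)
    have "h x \<in> B"
      using funcset_mem[OF continuous_map_funspace[OF h], of x] x by (simp add: top del: topspace_subtopology)
    then have "openin (subtopology (conf_space A I) K)
        {y \<in> K. h y \<in> {h x}}"
      using openin_continuous_map_preimage[OF h, of "{h x}"] by (simp add: top del: topspace_subtopology)
    then obtain U where U: "openin (conf_space A I) U"
        "{y \<in> K. h y \<in> {h x}} = U \<inter> K"
      unfolding openin_subtopology by blast
    have "x \<in> U"
      using U(2) x by blast
    from open_contains_cylinder[OF U(1) this] obtain D where
      "finite D" "D \<subseteq> I" "\<forall>y\<in>I \<rightarrow>\<^sub>E A. (\<forall>q\<in>D. y q = x q) \<longrightarrow> y \<in> U"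
      by blast
    then show ?thesis
      using U(2) K_sub by (intro exI[of _ D]) blast
  qed
  then obtain D where D: "\<And>x. x \<in> K \<Longrightarrow> finite (D x)" "\<And>x. x \<in> K \<Longrightarrow> D x \<subseteq> I"
      "\<And>x y. x \<in> K \<Longrightarrow> y \<in> K \<Longrightarrow> (\<forall>q\<in>D x. y q = x q) \<Longrightarrow> h y = h x"
    by metis
  define C where "C x = {y \<in> I \<rightarrow>\<^sub>E A. \<forall>q\<in>D x. y q = x q}" for x
  have "openin (conf_space A I) (C x)" if "x \<in> K" for x
  proof -
    have "C x = (\<Inter>q\<in>D x. {y \<in> topspace (conf_space A I). y q \<in> {x q}}) \<inter> topspace (conf_space A I)"
      by (auto simp: C_def conf_space_def)
    moreover have "openin (conf_space A I) {y \<in> topspace (conf_space A I). y q \<in> {x q}}"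
      if "q \<in> D x" for q
    proof -
      have "q \<in> I"
        using D(2)[OF \<open>x \<in> K\<close>] that by auto
      from continuous_map_conf_coord[OF this, of A "\<lambda>v. v"] show ?thesis
        by (rule openin_continuous_map_preimage) auto
    qed
    ultimately show ?thesis
      using D(1)[OF that] by (cases "D x = {}") auto
  qed
  moreover have "K \<subseteq> \<Union>(C ` K)"
    using K_sub by (auto simp: C_def)
  ultimately obtain \<F> where \<F>: "finite \<F>" "\<F> \<subseteq> C ` K" "K \<subseteq> \<Union>\<F>"
    using compactinD[OF K, of "C ` K"] by (metis (no_types, lifting) imageE)
  obtain K0 where K0: "finite K0" "K0 \<subseteq> K" "\<F> = C ` K0"
    using \<F>(1,2) by (meson finite_subset_image)
  show ?thesis
  proof (intro exI[of _ "\<Union>(D ` K0)"] conjI ballI impI)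
    fix x y assume x: "x \<in> K" and y: "y \<in> K" and eq: "\<forall>q\<in>\<Union>(D ` K0). x q = y q"
    obtain k where k: "k \<in> K0" "x \<in> C k"
      using x \<F>(3) K0(3) by auto
    then have "\<forall>q\<in>D k. x q = k q" "\<forall>q\<in>D k. y q = k q"
      using eq by (auto simp: C_def)
    then have "h x = h k" "h y = h k"
      using D(3)[of k x] D(3)[of k y] k(1) K0(2) x y by auto
    then show "h x = h y"
      by simp
  qed (use K0 D in auto)
qed

text \<open>Two points that agree on \<open>V \<inter> W\<close> are linked by a third one that agrees with one of them on \<open>V\<close>
  and with the other on \<open>W\<close>.\<close>

lemma determines_Int:
  assumes "determines A E f q V" "determines A E f q W"
  shows "determines A E f q (V \<inter> W)"
  unfolding determines_def
proof (intro ballI impI)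
  fix x y assume x: "x \<in> E \<rightarrow>\<^sub>E A" and y: "y \<in> E \<rightarrow>\<^sub>E A" and eq: "\<forall>e\<in>V \<inter> W. x e = y e"
  define z where "z = (\<lambda>e. if e \<in> V then x e else y e)"
  have "z \<in> E \<rightarrow>\<^sub>E A"
    using x y by (auto simp: z_def PiE_iff extensional_def)
  moreover have "\<forall>e\<in>V. x e = z e" "\<forall>e\<in>W. z e = y e"
    using eq by (auto simp: z_def)
  ultimately have "f x q = f z q" "f z q = f y q"
    using assms x y unfolding determines_def by blast+
  then show "f x q = f y q"
    by simp
qed

text \<open>A determining set of least size among the finite ones is contained in every determining set,
  finite or not, because intersecting the two cannot make it smaller. So the window, introduced as
  a least element, really is one.\<close>

lemma determines_window:
  fixes f :: "('e \<Rightarrow> 'a) \<Rightarrow> ('i \<Rightarrow> 'b)"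
  assumes "finite A" "q \<in> F"
    and cont: "continuous_map (conf_space A E) (conf_space S F) f"
  shows "determines A E f q (window A E f q)"
proof -
  have "compact_space (conf_space A E)"
    using assms by (simp add: conf_space_def compact_space_product_topology
        compact_space_discrete_topology)
  then have comp: "compactin (conf_space A E) (E \<rightarrow>\<^sub>E A)"
    unfolding compact_space_def by (simp add: conf_space_def)
  have "continuous_map (conf_space A E) (discrete_topology UNIV) (\<lambda>x. f x q)"
    using continuous_map_compose[OF cont continuous_map_conf_coord[OF \<open>q \<in> F\<close>, of S "\<lambda>v. v"]]
    by (simp add: o_def)
  then have "continuous_map (subtopology (conf_space A E) (E \<rightarrow>\<^sub>E A)) (discrete_topology UNIV) (\<lambda>x. f x q)"
    by (rule continuous_map_from_subtopology)
  from finite_determination[OF comp this] obtain D where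
    D: "finite D" "D \<subseteq> E" "\<forall>x\<in>E \<rightarrow>\<^sub>E A. \<forall>y\<in>E \<rightarrow>\<^sub>E A. (\<forall>e\<in>D. x e = y e) \<longrightarrow> f x q = f y q"
    by blast
  define good where "good W \<longleftrightarrow> finite W \<and> W \<subseteq> E \<and> determines A E f q W" for W
  have "good D"
    unfolding good_def determines_def using D by blast
  then obtain W where W: "good W" and least: "\<And>V. good V \<Longrightarrow> card W \<le> card V"
    using ex_has_least_nat[of good D card] by blast
  have "(LEAST W. W \<subseteq> E \<and> determines A E f q W) = W"
  proof (rule Least_equality)
    show "W \<subseteq> E \<and> determines A E f q W"
      using W by (simp add: good_def)
    fix V assume V: "V \<subseteq> E \<and> determines A E f q V"
    then have "good (W \<inter> V)"
      using W determines_Int[of A E f q W V] by (auto simp: good_def)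
    then have "W \<inter> V = W"
      using least W by (intro card_seteq) (auto simp: good_def)
    then show "W \<subseteq> V"
      by blast
  qed
  then show ?thesis
    using W unfolding window_def good_def by metis
qed

section \<open>Chains of juntas are short\<close>

text \<open>The letters outside \<open>V\<close> are free.\<close>

lemma card_cylindrical_set:
  assumes "finite W" "finite A" "V \<subseteq> W"
    and P: "\<And>w w'. w \<in> W \<rightarrow>\<^sub>E A \<Longrightarrow> w' \<in> W \<rightarrow>\<^sub>E A \<Longrightarrow> (\<And>e. e \<in> V \<Longrightarrow> w e = w' e) \<Longrightarrow> P w = P w'"
  shows "\<exists>e. card {w \<in> W \<rightarrow>\<^sub>E A. P w} = e * card A ^ (card W - card V)"
proof -
  let ?N = "{w \<in> W \<rightarrow>\<^sub>E A. P w}" and ?R = "(W - V) \<rightarrow>\<^sub>E A"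
  let ?M = "(\<lambda>w. restrict w V) ` ?N"
  have "bij_betw (\<lambda>w. (restrict w V, restrict w (W - V))) ?N (?M \<times> ?R)"
  proof (rule bij_betwI')
    fix w w' assume w: "w \<in> ?N" and w': "w' \<in> ?N"
    have "w = w'" if V: "restrict w V = restrict w' V" and U: "restrict w (W - V) = restrict w' (W - V)"
    proof
      fix e
      consider "e \<in> V" | "e \<in> W - V" | "e \<notin> W"
        using assms(3) by blast
      then show "w e = w' e"
      proof cases
        case 1
        then show ?thesis using fun_cong[OF V, of e] by simp
      next
        case 2
        then show ?thesis using fun_cong[OF U, of e] by simp
      next
        case 3
        then show ?thesis using w w' by (simp add: PiE_iff extensional_def)
      qed
    qed
    then show "((restrict w V, restrict w (W - V)) = (restrict w' V, restrict w' (W - V))) = (w = w')"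
      by auto
  next
    fix w assume "w \<in> ?N"
    then show "(restrict w V, restrict w (W - V)) \<in> ?M \<times> ?R"
      by (auto simp: PiE_iff)
  next
    fix vu assume vu: "vu \<in> ?M \<times> ?R"
    then obtain w u where w: "w \<in> ?N" and u: "u \<in> ?R" and vu: "vu = (restrict w V, u)"
      by auto
    define z where "z = (\<lambda>e. if e \<in> V then w e else u e)"
    have z: "z \<in> W \<rightarrow>\<^sub>E A"
      using w u assms(3) by (auto simp: z_def PiE_iff extensional_def)
    moreover have "P z"
      using P[of z w] z w by (simp add: z_def)
    moreover have "vu = (restrict z V, restrict z (W - V))"
      using u unfolding vu by (simp add: z_def fun_eq_iff PiE_iff extensional_def)
    ultimately show "\<exists>w\<in>?N. vu = (restrict w V, restrict w (W - V))"
      by blast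
  qed
  from bij_betw_same_card[OF this]
  have "card ?N = card ?M * card A ^ (card W - card V)"
    using assms finite_subset[OF assms(3,1)] by (simp add: card_cartesian_product card_PiE card_Diff_subset)
  then show ?thesis
    by blast
qed

text \<open>Restrict attention to the finite set \<open>W\<close> of all coordinates that matter. The number of words on
  \<open>W\<close> that satisfy \<open>P k\<close>, as a fraction of all of them, is a multiple of \<open>card A ^ (- R)\<close>, strictly
  increases with \<open>k\<close>, and is at most 1.\<close>

lemma chain_of_juntas_bounded:
  fixes P :: "nat \<Rightarrow> ('e \<Rightarrow> 'a) \<Rightarrow> bool"
  assumes "finite A"
    and local: "\<And>k. k \<le> m \<Longrightarrow> \<exists>V. finite V \<and> card V \<le> R \<and>
          (\<forall>x\<in>UNIV \<rightarrow>\<^sub>E A. \<forall>y\<in>UNIV \<rightarrow>\<^sub>E A. (\<forall>e\<in>V. x e = y e) \<longrightarrow> P k x = P k y)"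
    and mono: "\<And>k x. k < m \<Longrightarrow> x \<in> UNIV \<rightarrow>\<^sub>E A \<Longrightarrow> P k x \<Longrightarrow> P (Suc k) x"
    and strict: "\<And>k. k < m \<Longrightarrow> \<exists>x\<in>UNIV \<rightarrow>\<^sub>E A. \<not> P k x \<and> P (Suc k) x"
  shows "m \<le> card A ^ R"
proof (cases "m = 0")
  case False
  then obtain x0 where x0: "x0 \<in> (UNIV :: 'e set) \<rightarrow>\<^sub>E A"
    using strict[of 0] by blast
  obtain V where V: "\<And>k. k \<le> m \<Longrightarrow> finite (V k)" "\<And>k. k \<le> m \<Longrightarrow> card (V k) \<le> R"
      "\<And>k x y. k \<le> m \<Longrightarrow> x \<in> UNIV \<rightarrow>\<^sub>E A \<Longrightarrow> y \<in> UNIV \<rightarrow>\<^sub>E A \<Longrightarrow>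
          (\<forall>e\<in>V k. x e = y e) \<Longrightarrow> P k x = P k y"
    using local by metis
  define W where "W = (\<Union>k\<le>m. V k)"
  have W: "finite W" "\<And>k. k \<le> m \<Longrightarrow> V k \<subseteq> W"
    using V(1) by (auto simp: W_def)
  define ext where "ext w = (\<lambda>e. if e \<in> W then w e else x0 e)" for w
  have ext: "ext w \<in> UNIV \<rightarrow>\<^sub>E A" if "w \<in> W \<rightarrow>\<^sub>E A" for w
    using that x0 by (auto simp: ext_def PiE_iff)
  have ext_restrict: "P k (ext (restrict x W)) = P k x" if "k \<le> m" "x \<in> UNIV \<rightarrow>\<^sub>E A" for k x
    using that W(2)[of k] x0 by (intro V(3)) (auto simp: ext_def PiE_iff)
  define N where "N k = {w \<in> W \<rightarrow>\<^sub>E A. P k (ext w)}" for k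
  have fin: "finite (W \<rightarrow>\<^sub>E A)"
    using W(1) assms(1) by (intro finite_PiE) auto
  have A_pos: "card A > 0"
    using x0 assms(1) by (auto simp: card_gt_0_iff PiE_iff)
  \<comment> \<open>Multiplying by \<open>card A ^ R\<close> keeps the exponents natural numbers even if \<open>R\<close> exceeds \<open>card W\<close>.\<close>
  have "\<exists>e. card (N k) * card A ^ R = e * card A ^ card W" if k: "k \<le> m" for k
  proof -
    have "\<exists>e. card (N k) = e * card A ^ (card W - card (V k))"
      unfolding N_def
    proof (rule card_cylindrical_set[OF W(1) assms(1) W(2)[OF k]])
      fix w w' assume "w \<in> W \<rightarrow>\<^sub>E A" "w' \<in> W \<rightarrow>\<^sub>E A" "\<And>e. e \<in> V k \<Longrightarrow> w e = w' e"
      then show "P k (ext w) = P k (ext w')"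
        using k ext by (intro V(3)) (auto simp: ext_def)
    qed
    then obtain e where e: "card (N k) = e * card A ^ (card W - card (V k))"
      by blast
    have "card W - card (V k) + R = card W + (R - card (V k))"
      using V(2)[OF k] card_mono[OF W(1) W(2)[OF k]] by linarith
    then have "card (N k) * card A ^ R = (e * card A ^ (R - card (V k))) * card A ^ card W"
      unfolding e by (metis mult.assoc mult.commute power_add)
    then show ?thesis ..
  qed
  then obtain e where e: "\<And>k. k \<le> m \<Longrightarrow> card (N k) * card A ^ R = e k * card A ^ card W"
    by metis
  have "card (N k) < card (N (Suc k))" if k: "k < m" for k
  proof (rule psubset_card_mono)
    show "finite (N (Suc k))"
      using fin by (simp add: N_def)
    obtain x where x: "x \<in> UNIV \<rightarrow>\<^sub>E A" "\<not> P k x" "P (Suc k) x"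
      using strict[OF k] by blast
    have "restrict x W \<in> N (Suc k) - N k"
      using x k by (auto simp: N_def ext_restrict PiE_iff)
    moreover have "N k \<subseteq> N (Suc k)"
      using mono[OF k] ext by (auto simp: N_def)
    ultimately show "N k \<subset> N (Suc k)"
      by blast
  qed
  then have "e k < e (Suc k)" if "k < m" for k
    using e[of k] e[of "Suc k"] that A_pos
    by (metis Suc_leI less_imp_le_nat mult_less_cancel2 zero_less_power)
  then have "k \<le> e k" if "k \<le> m" for k
    using that by (induction k) (auto, metis Suc_leI Suc_le_lessD less_imp_le_nat order.strict_trans1)
  moreover have "e m \<le> card A ^ R"
  proof -
    have "card (N m) \<le> card A ^ card W"
      using card_mono[OF fin, of "N m"] W(1) by (simp add: N_def card_PiE)
    then have "e m * card A ^ card W \<le> card A ^ R * card A ^ card W"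
      using e[of m] by (metis mult.commute mult_le_mono1 order_refl)
    then show ?thesis
      using A_pos by simp
  qed
  ultimately show ?thesis
    using order.trans by blast
qed simp

section \<open>An obstruction to membership in the class\<close>

text \<open>Baire category, applied to the closure of \<open>Y\<close> instead of \<open>X\<close>: some image then has nonempty
  interior in that closure, and by density its interior contains a point of \<open>Y\<close>. Restricting to
  a convenient family \<open>Y\<close> dispenses with a description of all points of \<open>X\<close>.\<close>

lemma class_L1_contains_cylinder:
  fixes X Y :: "('i \<Rightarrow> 'a) set"
  assumes X: "X \<in> class_L1 S F" and Y: "Y \<subseteq> X" "Y \<noteq> {}"
  shows "\<exists>(A :: nat set) r f. finite A \<and> continuous_map (conf_space A UNIV) (conf_space S F) f \<and>
    f ` ((UNIV :: nat set) \<rightarrow>\<^sub>E A) \<subseteq> X \<and> narrow A UNIV F r f \<and>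
    (\<exists>y\<in>Y. \<exists>D. finite D \<and> (\<forall>z\<in>Y. (\<forall>q\<in>D. z q = y q) \<longrightarrow> z \<in> f ` (UNIV \<rightarrow>\<^sub>E A)))"
proof -
  have comp: "compactin (conf_space S F) X"
    using X by (simp add: class_L1_def)
  obtain A :: "nat \<Rightarrow> nat set" and r :: "nat \<Rightarrow> nat"
    and f :: "nat \<Rightarrow> (nat \<Rightarrow> nat) \<Rightarrow> 'i \<Rightarrow> 'a"
    where Arf: "\<forall>n. finite (A n) \<and>
             continuous_map (conf_space (A n) UNIV) (subtopology (conf_space S F) X) (f n) \<and>
             narrow (A n) UNIV F (r n) (f n)"
      and X_eq: "X = (\<Union>n. f n ` (UNIV \<rightarrow>\<^sub>E A n))"
    using X unfolding class_L1_def mem_Collect_eq by (elim conjE exE) (rule that; assumption)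
  have A: "finite (A n)"
    and cont: "continuous_map (conf_space (A n) UNIV) (subtopology (conf_space S F) X) (f n)"
    and nar: "narrow (A n) UNIV F (r n) (f n)" for n
    using Arf by blast+
  have Haus: "Hausdorff_space (conf_space S F)"
    by (simp add: conf_space_def Hausdorff_space_product_topology)
  have X_closed: "closedin (conf_space S F) X"
    using compactin_imp_closedin[OF Haus comp] .
  have X_top: "X \<subseteq> topspace (conf_space S F)"
    using compactin_subset_topspace[OF comp] .
  define C where "C = (conf_space S F) closure_of Y"
  have C: "C \<subseteq> X" "Y \<subseteq> C" "closedin (conf_space S F) C"
    using Y(1) X_closed X_top by (auto simp: C_def closure_of_minimal closure_of_subset)
  define Z where "Z = subtopology (conf_space S F) C"
  have "compactin (conf_space S F) C"
    using closed_compactin[OF comp C(1,3)] .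
  then have "compact_space Z"
    unfolding Z_def by (rule compact_space_subtopology)
  moreover have "Hausdorff_space Z"
    unfolding Z_def using Haus by (rule Hausdorff_space_subtopology)
  ultimately have Z: "locally_compact_space Z" "regular_space Z"
    by (auto simp: compact_imp_locally_compact_space compact_Hausdorff_imp_regular_space)
  have Z_top: "topspace Z = C"
    using C(1) X_top by (auto simp: Z_def)
  define B where "B n = f n ` (UNIV \<rightarrow>\<^sub>E A n) \<inter> C" for n
  have cont': "continuous_map (conf_space (A n) UNIV) (conf_space S F) (f n)" for n
    using cont[of n] by (simp add: continuous_map_in_subtopology)
  have closed: "closedin Z (B n)" for n
  proof -
    have "compact_space (conf_space (A n) (UNIV :: nat set))"
      using A by (simp add: conf_space_def compact_space_product_topology
          compact_space_discrete_topology)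
    then have "compactin (conf_space (A n) UNIV) ((UNIV :: nat set) \<rightarrow>\<^sub>E A n)"
      unfolding compact_space_def by (simp add: conf_space_def)
    from image_compactin[OF this cont'] have "closedin (conf_space S F) (f n ` (UNIV \<rightarrow>\<^sub>E A n))"
      by (rule compactin_imp_closedin[OF Haus])
    then show ?thesis
      unfolding Z_def B_def closedin_subtopology by blast
  qed
  have nonempty: "Z interior_of \<Union>(range B) \<noteq> {}"
  proof -
    have "\<Union>(range B) = topspace Z"
      using C(1) X_eq unfolding Z_top B_def by blast
    then have "Z interior_of \<Union>(range B) = C"
      by (metis interior_of_topspace Z_top)
    then show ?thesis
      using C(2) Y(2) by blast
  qed
  obtain n where n: "Z interior_of B n \<noteq> {}"
  proof (rule ccontr)
    assume "\<not> thesis"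
    then have "Z interior_of B n = {}" for n
      using that by blast
    then have "Z interior_of \<Union>(range B) = {}"
      using Z closed by (intro Baire_category_alt) auto
    then show False
      using nonempty by blast
  qed
  obtain U where U: "openin (conf_space S F) U" "Z interior_of B n = U \<inter> C"
    using openin_interior_of[of Z "B n"] unfolding Z_def openin_subtopology by blast
  have "U \<inter> Y \<noteq> {}"
    using n U openin_Int_closure_of_eq_empty[of "conf_space S F" U Y] unfolding C_def by auto
  then obtain y where y: "y \<in> U" "y \<in> Y"
    by blast
  from open_contains_cylinder[OF U(1) y(1)] obtain D where
    D: "finite D" "D \<subseteq> F" "\<forall>z\<in>F \<rightarrow>\<^sub>E S. (\<forall>q\<in>D. z q = y q) \<longrightarrow> z \<in> U"
    by blast
  have "f n ` (UNIV \<rightarrow>\<^sub>E A n) \<subseteq> X"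
    using X_eq by blast
  moreover have "z \<in> f n ` (UNIV \<rightarrow>\<^sub>E A n)" if z: "z \<in> Y" "\<forall>q\<in>D. z q = y q" for z
  proof -
    have "z \<in> F \<rightarrow>\<^sub>E S"
      using z(1) Y(1) X_top by (auto simp: conf_space_def)
    from bspec[OF D(3) this] have "z \<in> U"
      using z(2) by simp
    then have "z \<in> Z interior_of B n"
      using U(2) z(1) C(2) by auto
    then have "z \<in> B n"
      by (rule subsetD[OF interior_of_subset])
    then show ?thesis
      by (simp add: B_def)
  qed
  ultimately show ?thesis
    using A[of n] cont'[of n] nar[of n] y(2) D(1)
    by (intro exI[of _ "A n"] exI[of _ "r n"] exI[of _ "f n"] conjI bexI[of _ y] exI[of _ D]) auto
qed

text \<open>The number \<open>c\<close> of cells from which a property is read off must not depend on the cylinder or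
  on the length of the chain: the bound on that length is \<open>card A ^ (c * r)\<close>.\<close>

lemma not_class_L1_if_chains:
  fixes X Y :: "('i \<Rightarrow> 'a) set" and c :: nat
  assumes Y: "Y \<subseteq> X" "Y \<noteq> {}"
    and chains: "\<And>y D m. y \<in> Y \<Longrightarrow> finite D \<Longrightarrow> \<exists>P :: nat \<Rightarrow> ('i \<Rightarrow> 'a) \<Rightarrow> bool.
        (\<forall>k. \<exists>W. finite W \<and> W \<subseteq> F \<and> card W \<le> c \<and>
             (\<forall>x\<in>X. \<forall>x'\<in>X. (\<forall>q\<in>W. x q = x' q) \<longrightarrow> P k x = P k x')) \<and>
        (\<forall>k. \<forall>x\<in>X. P k x \<longrightarrow> P (Suc k) x) \<and>
        (\<forall>k<m. \<exists>z\<in>Y. (\<forall>q\<in>D. z q = y q) \<and> \<not> P k z \<and> P (Suc k) z)"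
  shows "X \<notin> class_L1 S F"
proof
  assume "X \<in> class_L1 S F"
  from class_L1_contains_cylinder[OF this Y] obtain A :: "nat set" and r
    and f :: "(nat \<Rightarrow> nat) \<Rightarrow> 'i \<Rightarrow> 'a" and y D where
    A: "finite A" and cont: "continuous_map (conf_space A UNIV) (conf_space S F) f"
    and im: "f ` (UNIV \<rightarrow>\<^sub>E A) \<subseteq> X" and nar: "narrow A UNIV F r f" and y: "y \<in> Y"
    and D: "finite D"
    and cyl: "\<forall>z\<in>Y. (\<forall>q\<in>D. z q = y q) \<longrightarrow> z \<in> f ` (UNIV \<rightarrow>\<^sub>E A)"
    by (elim exE conjE bexE) (rule that; assumption)
  define m where "m = Suc (card A ^ (c * r))"
  from chains[OF y D, of m] obtain P where
    loc: "\<forall>k. \<exists>W. finite W \<and> W \<subseteq> F \<and> card W \<le> c \<and>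
             (\<forall>x\<in>X. \<forall>x'\<in>X. (\<forall>q\<in>W. x q = x' q) \<longrightarrow> P k x = P k x')"
    and mono: "\<forall>k. \<forall>x\<in>X. P k x \<longrightarrow> P (Suc k) x"
    and strict: "\<forall>k<m. \<exists>z\<in>Y. (\<forall>q\<in>D. z q = y q) \<and> \<not> P k z \<and> P (Suc k) z"
    by (elim exE conjE) (rule that; assumption)
  have "m \<le> card A ^ (c * r)"
  proof (rule chain_of_juntas_bounded[OF A, of m "c * r" "\<lambda>k x. P k (f x)"])
    fix k
    obtain W where W: "finite W" "W \<subseteq> F" "card W \<le> c"
        "\<forall>x\<in>X. \<forall>x'\<in>X. (\<forall>q\<in>W. x q = x' q) \<longrightarrow> P k x = P k x'"
      using spec[OF loc, of k] by (elim exE conjE) (rule that; assumption)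
    define V where "V = (\<Union>q\<in>W. window A UNIV f q)"
    have win: "finite (window A UNIV f q)" "card (window A UNIV f q) \<le> r" if "q \<in> W" for q
      using nar that W(2) by (auto simp: narrow_def)
    have "card V \<le> (\<Sum>q\<in>W. card (window A UNIV f q))"
      unfolding V_def by (rule card_UN_le[OF W(1)])
    also have "\<dots> \<le> card W * r"
      using sum_bounded_above[of W "\<lambda>q. card (window A UNIV f q)" r] win by simp
    also have "\<dots> \<le> c * r"
      using W(3) by simp
    finally have "card V \<le> c * r" .
    moreover have "finite V"
      using W(1) win by (auto simp: V_def)
    moreover have "P k (f x) = P k (f x')"
      if x: "x \<in> UNIV \<rightarrow>\<^sub>E A" "x' \<in> UNIV \<rightarrow>\<^sub>E A" "\<forall>e\<in>V. x e = x' e" for x x'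
    proof -
      have "f x \<in> X" "f x' \<in> X"
        using im x by auto
      moreover have "\<forall>q\<in>W. f x q = f x' q"
      proof
        fix q assume q: "q \<in> W"
        then have "determines A UNIV f q (window A UNIV f q)"
          using W(2) by (intro determines_window[OF A _ cont]) auto
        moreover have "\<forall>e\<in>window A UNIV f q. x e = x' e"
          using x(3) q by (auto simp: V_def)
        ultimately show "f x q = f x' q"
          using x(1,2) unfolding determines_def by blast
      qed
      ultimately show ?thesis
        using W(4) by blast
    qed
    ultimately show "\<exists>V. finite V \<and> card V \<le> c * r \<and> (\<forall>x\<in>UNIV \<rightarrow>\<^sub>E A. \<forall>y\<in>UNIV \<rightarrow>\<^sub>E A.
        (\<forall>e\<in>V. x e = y e) \<longrightarrow> P k (f x) = P k (f y))"
      by blast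
  next
    fix k and x :: "nat \<Rightarrow> nat" assume x: "x \<in> UNIV \<rightarrow>\<^sub>E A" "P k (f x)"
    have "f x \<in> X"
      using subsetD[OF im imageI[OF x(1)]] .
    then show "P (Suc k) (f x)"
      using mono x(2) by simp
  next
    fix k assume "k < m"
    then obtain z where z: "z \<in> Y" "\<forall>q\<in>D. z q = y q" "\<not> P k z" "P (Suc k) z"
      using strict by blast
    then have "z \<in> f ` (UNIV \<rightarrow>\<^sub>E A)"
      using cyl by simp
    then obtain x where "z = f x" "x \<in> UNIV \<rightarrow>\<^sub>E A"
      by (rule imageE)
    then show "\<exists>x\<in>UNIV \<rightarrow>\<^sub>E A. \<not> P k (f x) \<and> P (Suc k) (f x)"
      using z(3,4) by (intro bexI[of _ x]) simp_all
  qed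
  then show False
    by (simp add: m_def)
qed

section \<open>Independent translates\<close>

text \<open>Patterns of shape \<open>F\<close> and \<open>p + F\<close> are independent for some \<open>p\<close>. Since \<open>p\<close> is chosen before the
  patterns, the property passes to products.\<close>

definition independent_translates :: "('g::ab_group_add \<Rightarrow> 'a) set \<Rightarrow> bool" where
  "independent_translates X \<longleftrightarrow> (\<forall>F. finite F \<longrightarrow>
     (\<exists>p. \<forall>x\<in>X. \<forall>y\<in>X. \<exists>z\<in>X. \<forall>q\<in>F. z q = x q \<and> z (p + q) = y q))"

lemma weakly_mixing_if_independent_translates:
  fixes X :: "('g::ab_group_add \<Rightarrow> 'a) set"
  assumes X: "\<And>p x. x \<in> X \<Longrightarrow> shift p x \<in> X" and ind: "independent_translates X"
  shows "weakly_mixing X"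
  unfolding weakly_mixing_def transitive_shift_def
proof (intro allI impI)
  fix F G :: "'g set" and \<pi> \<rho> :: "'g \<Rightarrow> 'a \<times> 'a"
  assume F: "finite F" and G: "finite G"
    and \<pi>: "valid_pattern (product_shift X X) F \<pi>" and \<rho>: "valid_pattern (product_shift X X) G \<rho>"
  have recentre: "\<exists>x\<in>X. \<exists>y\<in>X. \<forall>q\<in>H. (x q, y q) = \<tau> q"
    if H: "valid_pattern (product_shift X X) H \<tau>" for H and \<tau> :: "'g \<Rightarrow> 'a \<times> 'a"
  proof -
    obtain x y p where xy: "x \<in> X" "y \<in> X" "\<forall>q\<in>H. shift p (\<lambda>p. (x p, y p)) q = \<tau> q"
      using H unfolding valid_pattern_def appears_in_def product_shift_def by blast
    show ?thesis
    proof (rule bexI[of _ "shift p x"], rule bexI[of _ "shift p y"])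
      show "\<forall>q\<in>H. (shift p x q, shift p y q) = \<tau> q"
        using xy(3) by (simp add: shift_def)
    qed (use X xy in auto)
  qed
  obtain x1 x2 where x: "x1 \<in> X" "x2 \<in> X" "\<forall>q\<in>F. (x1 q, x2 q) = \<pi> q"
    using recentre[OF \<pi>] by (elim bexE) (rule that; assumption)
  obtain y1 y2 where y: "y1 \<in> X" "y2 \<in> X" "\<forall>q\<in>G. (y1 q, y2 q) = \<rho> q"
    using recentre[OF \<rho>] by (elim bexE) (rule that; assumption)
  have "finite (F \<union> G)"
    using F G by simp
  from ind[unfolded independent_translates_def, rule_format, OF this]
  obtain p where p: "\<forall>x\<in>X. \<forall>y\<in>X. \<exists>z\<in>X. \<forall>q\<in>F \<union> G. z q = x q \<and> z (p + q) = y q"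
    by (rule exE)
  obtain z1 where z1: "z1 \<in> X" "\<forall>q\<in>F \<union> G. z1 q = x1 q \<and> z1 (p + q) = y1 q"
    using bspec[OF bspec[OF p x(1)] y(1)] by (rule bexE)
  obtain z2 where z2: "z2 \<in> X" "\<forall>q\<in>F \<union> G. z2 q = x2 q \<and> z2 (p + q) = y2 q"
    using bspec[OF bspec[OF p x(2)] y(2)] by (rule bexE)
  have "appears_in F \<pi> (\<lambda>q. (z1 q, z2 q))"
    unfolding appears_in_def using z1(2) z2(2) x(3) by (intro exI[of _ 0]) (simp add: shift_def)
  moreover have "appears_in G \<rho> (\<lambda>q. (z1 q, z2 q))"
    unfolding appears_in_def using z1(2) z2(2) y(3) by (intro exI[of _ p]) (simp add: shift_def)
  ultimately show "\<exists>x\<in>product_shift X X. appears_in F \<pi> x \<and> appears_in G \<rho> x"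
    using z1(1) z2(1) by (intro bexI[of _ "\<lambda>q. (z1 q, z2 q)"]) (auto simp: product_shift_def)
qed

lemma Zbar_step: "y \<in> Zbar \<Longrightarrow> y n = 1 \<Longrightarrow> y (n + 1) = 1"
  unfolding Zbar_def using bit_not_zero_iff[of "y (n + 1)"] by blast

lemma not_class_L1_if_weak_factor_Zbar:
  fixes X :: "('g::ab_group_add \<Rightarrow> 'a) set"
  assumes ind: "independent_translates X" and wf: "weak_factor UNIV Zbar A X"
  shows "X \<notin> class_L1 A UNIV"
proof -
  obtain g and \<phi> :: "int \<Rightarrow> 'g" where X: "subshift A X"
    and cont: "continuous_map (subtopology (conf_space A UNIV) X)
                  (subtopology (conf_space UNIV UNIV) Zbar) g"
    and onto: "g ` X = Zbar" and \<phi>: "Modules.additive \<phi>"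
    and equi: "\<forall>p. \<forall>x\<in>X. shift p (g x) = g (shift (\<phi> p) x)"
    using wf unfolding weak_factor_def by (elim conjE exE) (rule that; assumption)
  interpret \<phi>: Modules.additive \<phi> by (rule \<phi>)
  have shiftX: "shift p x \<in> X" if "x \<in> X" for p x
    using X that by (auto simp: subshift_def)
  have "continuous_map (subtopology (conf_space A UNIV) X) (conf_space UNIV UNIV) g"
    using cont by (simp add: continuous_map_in_subtopology)
  from continuous_map_compose[OF this continuous_map_conf_coord[of 0 UNIV UNIV "\<lambda>v. v"]]
  have "continuous_map (subtopology (conf_space A UNIV) X) (discrete_topology UNIV) (\<lambda>x. g x 0)"
    by (simp add: o_def)
  from finite_determination[OF compactin_subshift[OF X] this] obtain D where D: "finite D"
    "\<forall>x\<in>X. \<forall>y\<in>X. (\<forall>q\<in>D. x q = y q) \<longrightarrow> g x 0 = g y 0"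
    by blast
  have g_coord: "g x k = g (shift (\<phi> k) x) 0" if "x \<in> X" for x k
    using fun_cong[OF equi[rule_format, OF that, of k], of 0] by (simp add: shift_def)
  have local: "g x k = g y k" if "x \<in> X" "y \<in> X" "\<And>q. q \<in> D \<Longrightarrow> x (\<phi> k + q) = y (\<phi> k + q)" for x y k
  proof -
    have "\<forall>q\<in>D. shift (\<phi> k) x q = shift (\<phi> k) y q"
      using that(3) by (simp add: shift_def)
    then have "g (shift (\<phi> k) x) 0 = g (shift (\<phi> k) y) 0"
      using bspec[OF bspec[OF D(2) shiftX[OF that(1)]] shiftX[OF that(2)]] by blast
    then show ?thesis
      by (simp only: g_coord[OF that(1), of k] g_coord[OF that(2), of k])
  qed
  have "X \<noteq> {}"
    using onto by (auto simp: Zbar_def)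
  show ?thesis
  proof (rule not_class_L1_if_chains[OF subset_refl \<open>X \<noteq> {}\<close>, where c = "card D"])
    fix y and D' :: "'g set" and m :: nat assume y: "y \<in> X" and D': "finite D'"
    \<comment> \<open>The shape holds both the cylinder and the cells that determine the symbols at \<open>0, \<dots>, m\<close> of
      the image in \<open>Zbar\<close>; the translated copy is used to prescribe these symbols.\<close>
    define G where "G = D' \<union> (\<Union>k\<le>m. (\<lambda>q. \<phi> (int k) + q) ` D)"
    have "finite G"
      using D(1) D' by (auto simp: G_def)
    from ind[unfolded independent_translates_def, rule_format, OF this]
    obtain p where p: "\<forall>y\<in>X. \<forall>x\<in>X. \<exists>z\<in>X. \<forall>q\<in>G. z q = y q \<and> z (p + q) = x q"
      by (rule exE)
    define P where "P k x \<longleftrightarrow> g (shift p x) (int k) = 1" for k and x :: "'g \<Rightarrow> 'a"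
    have "\<forall>k. \<exists>W. finite W \<and> W \<subseteq> UNIV \<and> card W \<le> card D \<and>
             (\<forall>x\<in>X. \<forall>x'\<in>X. (\<forall>q\<in>W. x q = x' q) \<longrightarrow> P k x = P k x')"
    proof
      fix k
      let ?W = "(\<lambda>q. p + (\<phi> (int k) + q)) ` D"
      have "\<forall>x\<in>X. \<forall>x'\<in>X. (\<forall>q\<in>?W. x q = x' q) \<longrightarrow> P k x = P k x'"
      proof (intro ballI impI)
        fix x x' assume x: "x \<in> X" "x' \<in> X" and eq: "\<forall>q\<in>?W. x q = x' q"
        have "g (shift p x) (int k) = g (shift p x') (int k)"
          using eq by (intro local shiftX x) (simp add: shift_def)
        then show "P k x = P k x'"
          by (simp add: P_def)
      qed
      then show "\<exists>W. finite W \<and> W \<subseteq> UNIV \<and> card W \<le> card D \<and>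
             (\<forall>x\<in>X. \<forall>x'\<in>X. (\<forall>q\<in>W. x q = x' q) \<longrightarrow> P k x = P k x')"
        by (intro exI[of _ ?W] conjI finite_imageI[OF D(1)] subset_UNIV card_image_le[OF D(1)])
    qed
    moreover have "\<forall>k. \<forall>x\<in>X. P k x \<longrightarrow> P (Suc k) x"
    proof (intro allI ballI impI)
      fix k x assume x: "x \<in> X" "P k x"
      have "g (shift p x) \<in> Zbar"
        using shiftX[OF x(1)] onto by blast
      then have "g (shift p x) (int k + 1) = 1"
        by (rule Zbar_step) (use x(2) in \<open>simp add: P_def\<close>)
      then show "P (Suc k) x"
        by (simp add: P_def add.commute)
    qed
    moreover have "\<forall>k<m. \<exists>z\<in>X. (\<forall>q\<in>D'. z q = y q) \<and> \<not> P k z \<and> P (Suc k) z"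
    proof (intro allI impI)
      fix k assume k: "k < m"
      have "(\<lambda>i. if i > int k then 1 else 0) \<in> g ` X"
        unfolding onto by (auto simp: Zbar_def)
      then obtain x where x: "(\<lambda>i. if i > int k then 1 else 0) = g x" "x \<in> X"
        by (rule imageE)
      from bspec[OF bspec[OF p y] x(2)]
      obtain z where z: "z \<in> X" "\<forall>q\<in>G. z q = y q \<and> z (p + q) = x q"
        by (rule bexE)
      have g_eq: "g (shift p z) (int l) = (if l > k then 1 else 0)" if "l \<le> m" for l
      proof -
        have "g (shift p z) (int l) = g x (int l)"
          using that z(2) by (intro local shiftX z(1) x(2)) (auto simp: shift_def G_def)
        then show ?thesis
          by (simp flip: x(1))
      qed
      show "\<exists>z\<in>X. (\<forall>q\<in>D'. z q = y q) \<and> \<not> P k z \<and> P (Suc k) z"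
      proof (rule bexI[of _ z], intro conjI)
        show "\<forall>q\<in>D'. z q = y q"
          using z(2) by (simp add: G_def)
        show "\<not> P k z" "P (Suc k) z"
          using g_eq[of k] g_eq[of "Suc k"] k unfolding P_def by simp_all
      qed (rule z(1))
    qed
    ultimately show "\<exists>P. (\<forall>k. \<exists>W. finite W \<and> W \<subseteq> UNIV \<and> card W \<le> card D \<and>
             (\<forall>x\<in>X. \<forall>x'\<in>X. (\<forall>q\<in>W. x q = x' q) \<longrightarrow> P k x = P k x')) \<and>
        (\<forall>k. \<forall>x\<in>X. P k x \<longrightarrow> P (Suc k) x) \<and>
        (\<forall>k<m. \<exists>z\<in>X. (\<forall>q\<in>D'. z q = y q) \<and> \<not> P k z \<and> P (Suc k) z)"
      by (intro exI[of _ P] conjI)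
  qed
qed

text \<open>Up to a shift, \<open>Zbar\<close> has three points: all white, all black, and a single switch. So three
  preimages suffice for surjectivity.\<close>

lemma weak_factor_Zbar_if_monotone_symbol:
  fixes h :: "'a \<Rightarrow> bit" and \<phi> :: "int \<Rightarrow> 'g::ab_group_add"
  assumes X: "subshift A X" and \<phi>: "Modules.additive \<phi>"
    and mono: "\<And>x. x \<in> X \<Longrightarrow> h (x 0) = 1 \<Longrightarrow> h (x (\<phi> 1)) = 1"
    and zeros: "\<exists>x\<in>X. \<forall>k. h (x (\<phi> k)) = 0"
    and ones: "\<exists>x\<in>X. \<forall>k. h (x (\<phi> k)) = 1"
    and step: "\<exists>x\<in>X. \<forall>k. h (x (\<phi> k)) = 1 \<longleftrightarrow> k > 0"
  shows "weak_factor UNIV Zbar A X"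
proof -
  interpret \<phi>: Modules.additive \<phi> by (rule \<phi>)
  define f where "f x = (\<lambda>k. h (x (\<phi> k)))" for x
  have shiftX: "shift p x \<in> X" if "x \<in> X" for p x
    using X that by (auto simp: subshift_def)
  have f_shift: "f (shift (\<phi> p) x) = shift p (f x)" for p x
    by (simp add: f_def shift_def \<phi>.add)
  have f_Zbar: "f x \<in> Zbar" if "x \<in> X" for x
  proof -
    have up: "f x (n + 1) = 1" if "f x n = 1" for n
      using mono[OF shiftX[OF \<open>x \<in> X\<close>], of "\<phi> n"] that by (simp add: f_def shift_def \<phi>.add)
    show ?thesis
      unfolding Zbar_def mem_Collect_eq
    proof (intro allI notI, elim conjE)
      fix n assume "f x n = 1" "f x (n + 1) = 0"
      with up[of n] show False
        by simp
    qed
  qed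
  have "y \<in> f ` X" if y: "y \<in> Zbar" for y
  proof -
    have up': "y m = 1" if "y n = 1" "n \<le> m" for n m
      using that(2,1) by (induction rule: int_ge_induct) (auto intro: Zbar_step[OF y])
    consider "\<forall>k. y k = 0" | "\<forall>k. y k = 1" | a b where "y a = 0" "y b = 1"
      using bit_not_zero_iff by blast
    then show ?thesis
    proof cases
      case 1
      then show ?thesis
        using zeros by (auto simp: f_def fun_eq_iff image_iff)
    next
      case 2
      then show ?thesis
        using ones by (auto simp: f_def fun_eq_iff image_iff)
    next
      case 3
      have "\<exists>c. y c = 0 \<and> y (c + 1) = 1"
      proof (rule ccontr)
        assume none: "\<nexists>c. y c = 0 \<and> y (c + 1) = 1"
        have "y k = 0" if "a \<le> k" for k
          using that
        proof (induction rule: int_ge_induct)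
          case (step k)
          then show ?case
            using none bit_not_one_iff[of "y (k + 1)"] by blast
        qed (rule 3(1))
        moreover have "a \<le> b"
          using up'[of b a] 3 by (cases "a \<le> b") auto
        ultimately show False
          using 3 by simp
      qed
      then obtain c where c: "y c = 0" "y (c + 1) = 1"
        by blast
      have y_iff: "y k = 1 \<longleftrightarrow> k - c > 0" for k
      proof (cases "k \<le> c")
        case True
        then have "y k \<noteq> 1"
          using up'[of k c] c(1) zero_neq_one by metis
        then show ?thesis
          using True by simp
      next
        case False
        then show ?thesis
          using up'[OF c(2), of k] by simp
      qed
      obtain x where x: "x \<in> X" "\<forall>k. h (x (\<phi> k)) = 1 \<longleftrightarrow> k > 0"
        using step by (rule bexE)
      have "f (shift (\<phi> (- c)) x) k = y k" for k
      proof -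
        have "f (shift (\<phi> (- c)) x) k = 1 \<longleftrightarrow> y k = 1"
          unfolding f_shift y_iff using x(2)[rule_format, of "k - c"] by (simp add: f_def shift_def)
        then show ?thesis
          using bit_not_one_iff by metis
      qed
      then have "f (shift (\<phi> (- c)) x) = y"
        by (rule ext)
      then show ?thesis
        using shiftX[OF x(1)] by blast
    qed
  qed
  then have "f ` X = Zbar"
    using f_Zbar by blast
  moreover have "continuous_map (subtopology (conf_space A UNIV) X)
      (subtopology (conf_space UNIV UNIV) Zbar) f"
    unfolding continuous_map_in_subtopology
  proof
    show "continuous_map (subtopology (conf_space A UNIV) X) (conf_space UNIV UNIV) f"
      unfolding conf_space_def[of UNIV] continuous_map_componentwise_UNIV f_def
      by (auto intro!: continuous_map_from_subtopology continuous_map_conf_coord)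
    show "f \<in> topspace (subtopology (conf_space A UNIV) X) \<rightarrow> Zbar"
      using f_Zbar by auto
  qed
  ultimately show ?thesis
    unfolding weak_factor_def using X subshift_Zbar \<phi> f_shift
    by (intro conjI exI[of _ f] exI[of _ \<phi>]) auto
qed

section \<open>Configurations of Wang tiles\<close>

abbreviation blank :: tile where
  "blank \<equiv> Tile 0 0 0 0"

text \<open>\<open>H\<close> and \<open>V\<close> tell which left and which lower edges are black. Naming each edge only once makes
  adjacent tiles match by construction.\<close>

definition edge_conf :: "(int \<Rightarrow> int \<Rightarrow> bool) \<Rightarrow> (int \<Rightarrow> int \<Rightarrow> bool) \<Rightarrow> int \<times> int \<Rightarrow> tile" where
  "edge_conf H V = (\<lambda>(i, j). Tile (of_bool (H i j)) (of_bool (V i (j + 1)))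
                                 (of_bool (H (i + 1) j)) (of_bool (V i j)))"

lemma edge_conf_in_wang_shift:
  assumes "\<And>i j. edge_conf H V (i, j) \<in> T"
  shows "edge_conf H V \<in> wang_shift T"
  using assms by (auto simp: wang_shift_def edge_conf_def)

definition black_left :: "(int \<times> int \<Rightarrow> tile) \<Rightarrow> int \<Rightarrow> int \<Rightarrow> bool" where
  "black_left x i j \<longleftrightarrow> left_edge (x (i, j)) = 1"

definition black_lower :: "(int \<times> int \<Rightarrow> tile) \<Rightarrow> int \<Rightarrow> int \<Rightarrow> bool" where
  "black_lower x i j \<longleftrightarrow> lower_edge (x (i, j)) = 1"

lemma of_bool_eq_1_bit: "of_bool (b = 1) = (b :: bit)"
  by (cases b) auto

lemma wang_shift_eq_edge_conf:
  assumes "x \<in> wang_shift T"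
  shows "x = edge_conf (black_left x) (black_lower x)"
proof
  fix q :: "int \<times> int"
  obtain i j where q: "q = (i, j)"
    by (cases q)
  have "right_edge (x (i, j)) = left_edge (x (i + 1, j))" "upper_edge (x (i, j)) = lower_edge (x (i, j + 1))"
    using assms by (auto simp: wang_shift_def)
  then show "x q = edge_conf (black_left x) (black_lower x) q"
    unfolding q by (cases "x (i, j)") (simp add: edge_conf_def black_left_def black_lower_def of_bool_eq_1_bit)
qed

lemma shift_wang_shift: "x \<in> wang_shift T \<Longrightarrow> shift p x \<in> wang_shift T"
  by (cases p) (simp add: wang_shift_def shift_def add.assoc[symmetric])

text \<open>The edges of the overlay are the sums of the edges, because a blank tile only contributes zeros;
  matching is therefore inherited.\<close>

lemma overlay_in_wang_shift:
  assumes x: "x \<in> wang_shift T" and y: "y \<in> wang_shift T"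
    and disj: "\<And>q. x q = blank \<or> y q = blank"
  shows "(\<lambda>q. if x q = blank then y q else x q) \<in> wang_shift T" (is "?z \<in> _")
proof -
  have edges: "left_edge (?z q) = left_edge (x q) + left_edge (y q)"
      "right_edge (?z q) = right_edge (x q) + right_edge (y q)"
      "upper_edge (?z q) = upper_edge (x q) + upper_edge (y q)"
      "lower_edge (?z q) = lower_edge (x q) + lower_edge (y q)" for q
    using disj[of q] by auto
  show ?thesis
    unfolding wang_shift_def mem_Collect_eq edges
    using x y by (simp add: wang_shift_def)
qed

text \<open>Two configurations with disjoint supports can be overlaid, so it is enough to complete
  each box to a configuration supported in a region \<open>R n\<close> that is disjoint from its translate by
  \<open>p n\<close>.\<close>

lemma independent_translates_wang_shift:
  fixes R :: "int \<Rightarrow> (int \<times> int) set" and p :: "int \<Rightarrow> int \<times> int"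
  assumes box_in_region: "\<And>n. 0 \<le> n \<Longrightarrow> {- n..n} \<times> {- n..n} \<subseteq> R n"
    and disjoint: "\<And>n q. 0 \<le> n \<Longrightarrow> q \<in> R n \<Longrightarrow> q - p n \<notin> R n"
    and completion: "\<And>n x. 0 \<le> n \<Longrightarrow> x \<in> wang_shift T \<Longrightarrow> \<exists>z\<in>wang_shift T.
      (\<forall>i\<in>{- n..n}. \<forall>j\<in>{- n..n}. z (i, j) = x (i, j)) \<and> (\<forall>q. q \<notin> R n \<longrightarrow> z q = blank)"
  shows "independent_translates (wang_shift T)"
  unfolding independent_translates_def
proof (intro allI impI)
  fix F :: "(int \<times> int) set" assume F: "finite F"
  define n where "n = Max (insert 0 ((\<lambda>(i, j). max \<bar>i\<bar> \<bar>j\<bar>) ` F))"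
  have "max \<bar>i\<bar> \<bar>j\<bar> \<le> n" if "(i, j) \<in> F" for i j
    unfolding n_def using F that by (intro Max_ge) force+
  then have F_box: "F \<subseteq> {- n..n} \<times> {- n..n}"
    by fastforce
  have n: "0 \<le> n"
    unfolding n_def using F by (intro Max_ge) auto
  note box_in_region = box_in_region[OF n] and disjoint = disjoint[OF n] and completion = completion[OF n]
  have "\<exists>z\<in>wang_shift T. \<forall>q\<in>F. z q = x q \<and> z (p n + q) = y q"
    if xy: "x \<in> wang_shift T" "y \<in> wang_shift T" for x y
  proof -
    obtain x' where x': "x' \<in> wang_shift T" "\<forall>i\<in>{- n..n}. \<forall>j\<in>{- n..n}. x' (i, j) = x (i, j)"
        "\<forall>q. q \<notin> R n \<longrightarrow> x' q = blank"
      using completion[OF xy(1)] by blast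
    obtain y' where y': "y' \<in> wang_shift T" "\<forall>i\<in>{- n..n}. \<forall>j\<in>{- n..n}. y' (i, j) = y (i, j)"
        "\<forall>q. q \<notin> R n \<longrightarrow> y' q = blank"
      using completion[OF xy(2)] by blast
    define z where "z = (\<lambda>q. if x' q = blank then shift (- p n) y' q else x' q)"
    have "z \<in> wang_shift T"
      unfolding z_def
    proof (rule overlay_in_wang_shift[OF x'(1) shift_wang_shift[OF y'(1)]])
      fix q
      show "x' q = blank \<or> shift (- p n) y' q = blank"
        using disjoint x'(3) y'(3) by (cases "q \<in> R n") (auto simp: shift_def simp del: split_paired_All)
    qed
    moreover have "z q = x q \<and> z (p n + q) = y q" if "q \<in> F" for q
    proof -
      have q: "q \<in> {- n..n} \<times> {- n..n}" and q_R: "q \<in> R n"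
        using that F_box box_in_region by auto
      have "q - p n \<notin> R n" "p n + q \<notin> R n"
        using disjoint[OF q_R] disjoint[of "p n + q"] q_R by auto
      then have "x' (p n + q) = blank" "y' (q - p n) = blank"
        using x'(3) y'(3) by blast+
      moreover have "x' q = x q" "y' q = y q"
        using q x'(2) y'(2) by auto
      ultimately show ?thesis
        by (simp add: z_def shift_def)
    qed
    ultimately show ?thesis
      by blast
  qed
  then show "\<exists>p. \<forall>x\<in>wang_shift T. \<forall>y\<in>wang_shift T. \<exists>z\<in>wang_shift T. \<forall>q\<in>F. z q = x q \<and> z (p + q) = y q"
    by blast
qed

section \<open>Completing a box to a configuration with small support\<close>

text \<open>Lines leave the box upwards or to the right, where they are continued forever. A line entering
  from below through column \<open>c\<close> is made to start at a corner in row \<open>c - 2 * n - 1\<close>; the corner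
  also emits a line to the right, which passes below the starting points of the columns further to
  the right, since these start higher. Lines entering from the left are treated symmetrically. No
  two of the added lines cross, and the support is an L-shaped region whose inner side bounds a
  free quadrant.\<close>

lemma completion_by_corners:
  fixes n :: int
  assumes T: "T\<^sub>1 \<subseteq> T" and n: "0 \<le> n" and x: "x \<in> wang_shift T"
  shows "\<exists>z\<in>wang_shift T. (\<forall>i\<in>{- n..n}. \<forall>j\<in>{- n..n}. z (i, j) = x (i, j)) \<and>
    (\<forall>q. q \<notin> {(i, j). - 3 * n - 1 \<le> i \<and> - 3 * n - 1 \<le> j \<and> (i \<le> n \<or> j \<le> n)} \<longrightarrow> z q = blank)"
proof -
  define hx where "hx = black_left x"
  define vx where "vx = black_lower x"
  define H where "H i j \<longleftrightarrow>
    (if - n \<le> j \<and> j \<le> n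
     then if i \<le> - n then hx (- n) j \<and> j - 2 * n - 1 < i else if n < i then hx (n + 1) j else hx i j
     else - 3 * n - 1 \<le> j \<and> j < - n \<and> vx (j + 2 * n + 1) (- n) \<and> j + 2 * n + 1 < i)" for i j
  define V where "V i j \<longleftrightarrow>
    (if - n \<le> i \<and> i \<le> n
     then if j \<le> - n then vx i (- n) \<and> i - 2 * n - 1 < j else if n < j then vx i (n + 1) else vx i j
     else - 3 * n - 1 \<le> i \<and> i < - n \<and> hx (- n) (i + 2 * n + 1) \<and> i + 2 * n + 1 < j)" for i j
  note defs = edge_conf_def H_def V_def T\<^sub>1_def
  have box: "edge_conf H V (i, j) = x (i, j)" if "- n \<le> i" "i \<le> n" "- n \<le> j" "j \<le> n" for i j
  proof -
    have "H i j = hx i j" "V i j = vx i j"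
      using that by (auto simp: H_def V_def)
    moreover have "H (i + 1) j = hx (i + 1) j"
      using that by (cases "i = n") (auto simp: H_def)
    moreover have "V i (j + 1) = vx i (j + 1)"
      using that by (cases "j = n") (auto simp: V_def)
    ultimately have "edge_conf H V (i, j) = edge_conf hx vx (i, j)"
      by (simp add: edge_conf_def)
    then show ?thesis
      unfolding hx_def vx_def by (simp flip: wang_shift_eq_edge_conf[OF x])
  qed
  have left: "edge_conf H V (i, j) \<in> T\<^sub>1" if "- n \<le> j" "j \<le> n" "i < - n" for i j
    by (cases i "j - 2 * n - 1" rule: linorder_cases) (use that n in \<open>simp_all add: defs\<close>)
  have below: "edge_conf H V (i, j) \<in> T\<^sub>1" if "- n \<le> i" "i \<le> n" "j < - n" for i j
    by (cases j "i - 2 * n - 1" rule: linorder_cases) (use that n in \<open>simp_all add: defs\<close>)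
  have right: "edge_conf H V (i, j) \<in> T\<^sub>1" if "- n \<le> j" "j \<le> n" "n < i" for i j
    using that n by (simp add: defs)
  have above: "edge_conf H V (i, j) \<in> T\<^sub>1" if "- n \<le> i" "i \<le> n" "n < j" for i j
    using that n by (simp add: defs)
  have corners: "edge_conf H V (i, j) \<in> T\<^sub>1" if "i < - n \<or> n < i" "j < - n \<or> n < j" for i j
    using that n by (elim disjE) (simp_all add: defs)
  have "edge_conf H V \<in> wang_shift T"
  proof (rule edge_conf_in_wang_shift)
    fix i j
    show "edge_conf H V (i, j) \<in> T"
    proof (cases "- n \<le> i \<and> i \<le> n \<and> - n \<le> j \<and> j \<le> n")
      case True
      then show ?thesis
        using box[of i j] x by (simp add: wang_shift_def)
    next
      case False
      then have "edge_conf H V (i, j) \<in> T\<^sub>1"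
        using left[of j i] below[of i j] right[of j i] above[of i j] corners[of i j] by linarith
      then show ?thesis
        using T by blast
    qed
  qed
  moreover have "edge_conf H V (i, j) = blank"
    if "\<not> (- 3 * n - 1 \<le> i \<and> - 3 * n - 1 \<le> j \<and> (i \<le> n \<or> j \<le> n))" for i j
  proof -
    from that consider "i < - 3 * n - 1" | "j < - 3 * n - 1" | "n < i" "n < j"
      by linarith
    then show ?thesis
      using n by cases (simp_all add: edge_conf_def H_def V_def)
  qed
  ultimately show ?thesis
    using box by (intro bexI[of _ "edge_conf H V"]) auto
qed

text \<open>Horizontal lines through the box are extended to both sides. A line leaving upwards through
  column \<open>c\<close> turns right in row \<open>2 * n + 1 - c\<close>. Columns further to the right turn in lower rows,
  so they have ended before the turned line passes above them. Lines entering from below are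
  treated by reflection, and the support lies in a horizontal strip.\<close>

lemma completion_by_turning_right:
  fixes n :: int
  assumes T: "T\<^sub>4 \<subseteq> T" and n: "0 \<le> n" and x: "x \<in> wang_shift T"
  shows "\<exists>z\<in>wang_shift T. (\<forall>i\<in>{- n..n}. \<forall>j\<in>{- n..n}. z (i, j) = x (i, j)) \<and>
    (\<forall>q. q \<notin> {(i, j). - 3 * n - 1 \<le> j \<and> j \<le> 3 * n + 1} \<longrightarrow> z q = blank)"
proof -
  define hx where "hx = black_left x"
  define vx where "vx = black_lower x"
  define H where "H i j \<longleftrightarrow>
    (if - n \<le> j \<and> j \<le> n
     then if i \<le> - n then hx (- n) j else if n < i then hx (n + 1) j else hx i j
     else if n < j then j \<le> 3 * n + 1 \<and> vx (2 * n + 1 - j) (n + 1) \<and> 2 * n + 1 - j < i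
     else - 3 * n - 1 \<le> j \<and> vx (j + 2 * n + 1) (- n) \<and> j + 2 * n + 1 < i)" for i j
  define V where "V i j \<longleftrightarrow> - n \<le> i \<and> i \<le> n \<and>
    (if n < j then vx i (n + 1) \<and> j \<le> 2 * n + 1 - i
     else if j \<le> - n then vx i (- n) \<and> i - 2 * n - 1 < j else vx i j)" for i j
  note defs = edge_conf_def H_def V_def T\<^sub>4_def
  have box: "edge_conf H V (i, j) = x (i, j)" if "- n \<le> i" "i \<le> n" "- n \<le> j" "j \<le> n" for i j
  proof -
    have "H i j = hx i j" "V i j = vx i j"
      using that by (auto simp: H_def V_def)
    moreover have "H (i + 1) j = hx (i + 1) j"
      using that by (cases "i = n") (auto simp: H_def)
    moreover have "V i (j + 1) = vx i (j + 1)"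
      using that by (cases "j = n") (auto simp: V_def)
    ultimately have "edge_conf H V (i, j) = edge_conf hx vx (i, j)"
      by (simp add: edge_conf_def)
    then show ?thesis
      unfolding hx_def vx_def by (simp flip: wang_shift_eq_edge_conf[OF x])
  qed
  have sides: "edge_conf H V (i, j) \<in> T\<^sub>4" if "- n \<le> j" "j \<le> n" "i < - n \<or> n < i" for i j
    using that n by (elim disjE) (simp_all add: defs)
  have below: "edge_conf H V (i, j) \<in> T\<^sub>4" if "- n \<le> i" "i \<le> n" "j < - n" for i j
    by (cases j "i - 2 * n - 1" rule: linorder_cases) (use that n in \<open>simp_all add: defs\<close>)
  have above: "edge_conf H V (i, j) \<in> T\<^sub>4" if "- n \<le> i" "i \<le> n" "n < j" for i j
    by (cases j "2 * n + 1 - i" rule: linorder_cases) (use that n in \<open>simp_all add: defs\<close>)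
  have corners: "edge_conf H V (i, j) \<in> T\<^sub>4" if "i < - n \<or> n < i" "j < - n \<or> n < j" for i j
    using that n by (elim disjE) (simp_all add: defs)
  have "edge_conf H V \<in> wang_shift T"
  proof (rule edge_conf_in_wang_shift)
    fix i j
    show "edge_conf H V (i, j) \<in> T"
    proof (cases "- n \<le> i \<and> i \<le> n \<and> - n \<le> j \<and> j \<le> n")
      case True
      then show ?thesis
        using box[of i j] x by (simp add: wang_shift_def)
    next
      case False
      then have "edge_conf H V (i, j) \<in> T\<^sub>4"
        using sides[of j i] below[of i j] above[of i j] corners[of i j] by linarith
      then show ?thesis
        using T by blast
    qed
  qed
  moreover have "edge_conf H V (i, j) = blank"
    if "\<not> (- 3 * n - 1 \<le> j \<and> j \<le> 3 * n + 1)" for i j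
  proof -
    from that consider "j < - 3 * n - 1" | "3 * n + 1 < j"
      by linarith
    then show ?thesis
      using n by cases (simp_all add: edge_conf_def H_def V_def)
  qed
  ultimately show ?thesis
    using box by (intro bexI[of _ "edge_conf H V"]) auto
qed

lemma matching_edges:
  assumes "x \<in> wang_shift T"
  shows "x (i, j) \<in> T" "right_edge (x (i, j)) = left_edge (x (i + 1, j))"
    "upper_edge (x (i, j)) = lower_edge (x (i, j + 1))"
  using assms by (auto simp: wang_shift_def)

lemma black_rows_extend_right:
  assumes x: "x \<in> wang_shift T" and T: "\<forall>t\<in>T. left_edge t = 1 \<longrightarrow> right_edge t = 1"
    and "left_edge (x (i, j)) = 1" "i \<le> i'"
  shows "left_edge (x (i', j)) = 1"
  using assms(4,3)
proof (induction rule: int_ge_induct)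
  case (step i')
  then show ?case
    using T matching_edges[OF x, of i' j] by auto
qed

text \<open>In \<open>T\<^sub>2\<close> an upper black edge and a lower black edge both mark the cell where the line of their
  row starts. A row has at most one such cell, and no tile has both edges.\<close>

lemma vertical_edges_T2:
  assumes x: "x \<in> wang_shift T\<^sub>2" and up: "lower_edge (x (i, j + 1)) = 1"
  shows "lower_edge (x (i', j)) = 0"
proof (rule ccontr)
  assume down: "lower_edge (x (i', j)) \<noteq> 0"
  have T2: "\<forall>t\<in>T\<^sub>2. left_edge t = 1 \<longrightarrow> right_edge t = 1"
    by (simp add: T\<^sub>2_def)
  have start: "x (i, j) = Tile 0 1 1 0" "x (i', j) = Tile 0 0 1 1"
    using matching_edges[OF x, of i j] matching_edges[OF x, of i' j] up down by (auto simp: T\<^sub>2_def)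
  have after: "left_edge (x (i + 1, j)) = 1" "left_edge (x (i' + 1, j)) = 1"
    using start matching_edges(2)[OF x, of i j] matching_edges(2)[OF x, of i' j] by simp_all
  consider "i + 1 \<le> i'" | "i' + 1 \<le> i" | "i = i'"
    by linarith
  then show False
    using start black_rows_extend_right[OF x T2 after(1), of i'] black_rows_extend_right[OF x T2 after(2), of i]
    by cases simp_all
qed

text \<open>At least one of two consecutive boundaries between rows is crossed by no line, so the
  configuration can be cut right at the box or one row further.\<close>

lemma completion_T2:
  fixes n :: int
  assumes n: "0 \<le> n" and x: "x \<in> wang_shift T\<^sub>2"
  shows "\<exists>z\<in>wang_shift T\<^sub>2. (\<forall>i\<in>{- n..n}. \<forall>j\<in>{- n..n}. z (i, j) = x (i, j)) \<and>
    (\<forall>q. q \<notin> {(i, j). - n - 1 \<le> j \<and> j \<le> n + 1} \<longrightarrow> z q = blank)"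
proof -
  have "\<exists>t\<in>{n, n + 1}. \<forall>i. lower_edge (x (i, t + 1)) = 0"
  proof (cases "\<forall>i. lower_edge (x (i, n + 1)) = 0")
    case False
    then show ?thesis
      using vertical_edges_T2[OF x, of _ "n + 1"] bit_not_zero_iff by blast
  qed auto
  then obtain t where t: "t = n \<or> t = n + 1" "\<And>i. lower_edge (x (i, t + 1)) = 0"
    by blast
  have "\<exists>b\<in>{- n, - n - 1}. \<forall>i. lower_edge (x (i, b)) = 0"
  proof (cases "\<forall>i. lower_edge (x (i, - n)) = 0")
    case False
    then show ?thesis
      using vertical_edges_T2[OF x, of _ "- n - 1"] bit_not_zero_iff by auto
  qed auto
  then obtain b where b: "b = - n \<or> b = - n - 1" "\<And>i. lower_edge (x (i, b)) = 0"
    by blast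
  define z where "z = (\<lambda>(i :: int, j). if b \<le> j \<and> j \<le> t then x (i, j) else blank)"
  have "z (i, j) \<in> T\<^sub>2" for i j
    using matching_edges(1)[OF x, of i j] by (simp add: z_def T\<^sub>2_def)
  moreover have "right_edge (z (i, j)) = left_edge (z (i + 1, j))" for i j
    using matching_edges(2)[OF x, of i j] by (simp add: z_def)
  moreover have "upper_edge (z (i, j)) = lower_edge (z (i, j + 1))" for i j
  proof -
    consider "j + 1 < b \<or> t < j" | "j + 1 = b" | "j = t" | "b \<le> j" "j + 1 \<le> t"
      by linarith
    then show ?thesis
      using matching_edges(3)[OF x, of i j] t(2)[of i] b(2)[of i] by cases (auto simp: z_def)
  qed
  ultimately have "z \<in> wang_shift T\<^sub>2"
    by (auto simp: wang_shift_def)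
  then show ?thesis
    using b(1) t(1) n by (intro bexI[of _ z]) (auto simp: z_def)
qed

lemma T5_cases:
  assumes "x \<in> wang_shift T\<^sub>5"
  shows "x (i, j) \<in> {Tile 0 0 0 0, Tile 1 1 1 1, Tile 1 1 0 0, Tile 0 1 1 0, Tile 0 0 1 1}"
  using matching_edges(1)[OF assms] by (simp add: T\<^sub>5_def)

text \<open>A line of \<open>T\<^sub>5\<close> entering a cell from below leaves it to the right, and one entering from the left
  leaves upwards. So lines are staircases that never stop.\<close>

lemma black_staircases_extend:
  assumes x: "x \<in> wang_shift T\<^sub>5"
  shows "lower_edge (x (i, j)) = 1 \<Longrightarrow> 0 \<le> k \<Longrightarrow> lower_edge (x (i + k, j + k)) = 1"
    and "left_edge (x (i, j)) = 1 \<Longrightarrow> 0 \<le> k \<Longrightarrow> left_edge (x (i + k, j + k)) = 1"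
proof -
  have low: "right_edge (x (i, j)) = 1" if "lower_edge (x (i, j)) = 1" for i j
    using T5_cases[OF x, of i j] that by auto
  have left: "upper_edge (x (i, j)) = 1" if "left_edge (x (i, j)) = 1" for i j
    using T5_cases[OF x, of i j] that by auto
  have low_step: "lower_edge (x (i + 1, j + 1)) = 1" if "lower_edge (x (i, j)) = 1" for i j
    using low[OF that] left[of "i + 1" j] matching_edges(2)[OF x, of i j] matching_edges(3)[OF x, of "i + 1" j] by simp
  have left_step: "left_edge (x (i + 1, j + 1)) = 1" if "left_edge (x (i, j)) = 1" for i j
    using left[OF that] low[of i "j + 1"] matching_edges(3)[OF x, of i j] matching_edges(2)[OF x, of i "j + 1"] by simp
  show "lower_edge (x (i, j)) = 1 \<Longrightarrow> 0 \<le> k \<Longrightarrow> lower_edge (x (i + k, j + k)) = 1"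
    by (rotate_tac, induction k rule: int_ge_induct) (simp, metis add.assoc low_step)
  show "left_edge (x (i, j)) = 1 \<Longrightarrow> 0 \<le> k \<Longrightarrow> left_edge (x (i + k, j + k)) = 1"
    by (rotate_tac, induction k rule: int_ge_induct) (simp, metis add.assoc left_step)
qed

text \<open>The staircases between the diagonals \<open>i - j = d\<close> and \<open>i - j = d - 1\<close> run along one common lane,
  which is black from some point on. A source, which is a tile \<open>0110\<close>, on either diagonal is the
  starting point of this lane, so there cannot be sources on both.\<close>

lemma sources_T5:
  assumes x: "x \<in> wang_shift T\<^sub>5" and src: "x (i, j) = Tile 0 1 1 0"
    and diag: "i' - j' = i - j - 1"
  shows "x (i', j') \<noteq> Tile 0 1 1 0"
proof
  assume src': "x (i', j') = Tile 0 1 1 0"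
  show False
  proof (cases "i \<le> i'")
    case True
    have "lower_edge (x (i, j + 1)) = 1"
      using src matching_edges(3)[OF x, of i j] by simp
    from black_staircases_extend(1)[OF x this, of "i' - i"] True diag
    have "lower_edge (x (i', j')) = 1"
      by (simp add: algebra_simps)
    then show False
      using src' by simp
  next
    case False
    have "left_edge (x (i' + 1, j')) = 1"
      using src' matching_edges(2)[OF x, of i' j'] by simp
    moreover have "i' + 1 + (i - (i' + 1)) = i" "j' + (i - (i' + 1)) = j"
      using diag by linarith+
    ultimately have "left_edge (x (i, j)) = 1"
      using black_staircases_extend(2)[OF x, of "i' + 1" j' "i - (i' + 1)"] False by simp
    then show False
      using src by simp
  qed
qed

text \<open>The left and upper edges of a cell on the diagonal \<open>d = i - j\<close> belong to the lane \<open>d\<close>, the right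
  and lower edges to the lane \<open>d + 1\<close>. A source starts both lanes at once, and it is the only tile
  that ties two lanes together. So lanes outside an interval can be erased if there is no source
  on the diagonals at its two ends, and among two consecutive diagonals one has no source.\<close>

lemma completion_T5:
  fixes n :: int
  assumes n: "0 \<le> n" and x: "x \<in> wang_shift T\<^sub>5"
  shows "\<exists>z\<in>wang_shift T\<^sub>5. (\<forall>i\<in>{- n..n}. \<forall>j\<in>{- n..n}. z (i, j) = x (i, j)) \<and>
    (\<forall>q. q \<notin> {(i, j). - 2 * n - 2 \<le> i - j \<and> i - j \<le> 2 * n + 2} \<longrightarrow> z q = blank)"
proof -
  define source where "source d \<longleftrightarrow> (\<exists>i j. i - j = d \<and> x (i, j) = Tile 0 1 1 0)" for d
  have source: "\<not> source (d - 1)" if "source d" for d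
    using that sources_T5[OF x] unfolding source_def by blast
  have "2 * n + 2 - 1 = 2 * n + 1"
    by simp
  then obtain hi where hi: "hi = 2 * n + 1 \<or> hi = 2 * n + 2" "\<not> source hi"
    using source[of "2 * n + 2"] by metis
  obtain lo where lo: "lo = - 2 * n \<or> lo = - 2 * n - 1" "\<not> source (lo - 1)"
    using source[of "- 2 * n - 1"] by metis
  define keep where "keep d b = (if lo \<le> d \<and> d \<le> hi then b else 0)" for d and b :: bit
  define z where "z = (\<lambda>(i, j). Tile (keep (i - j) (left_edge (x (i, j)))) (keep (i - j) (upper_edge (x (i, j))))
      (keep (i - j + 1) (right_edge (x (i, j)))) (keep (i - j + 1) (lower_edge (x (i, j)))))"
  have z_box: "z (i, j) = x (i, j)" if "lo \<le> i - j" "i - j + 1 \<le> hi" for i j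
    using that by (cases "x (i, j)") (simp add: z_def keep_def)
  have "z (i, j) \<in> T\<^sub>5" for i j
  proof -
    consider "lo \<le> i - j" "i - j + 1 \<le> hi" | "i - j = hi" | "i - j = lo - 1" | "i - j < lo - 1 \<or> hi < i - j"
      by linarith
    then show ?thesis
    proof cases
      case 1
      then show ?thesis
        using z_box matching_edges(1)[OF x] by simp
    next
      case 2
      then have "x (i, j) \<noteq> Tile 0 1 1 0"
        using hi(2) unfolding source_def by blast
      then show ?thesis
        using 2 T5_cases[OF x, of i j] by (auto simp: z_def keep_def T\<^sub>5_def)
    next
      case 3
      then have "x (i, j) \<noteq> Tile 0 1 1 0"
        using lo(2) unfolding source_def by blast
      then show ?thesis
        using 3 T5_cases[OF x, of i j] by (auto simp: z_def keep_def T\<^sub>5_def)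
    next
      case 4
      then have "\<not> (lo \<le> i - j \<and> i - j \<le> hi)" "\<not> (lo \<le> i - j + 1 \<and> i - j + 1 \<le> hi)"
        by linarith+
      then have "z (i, j) = blank"
        by (simp only: z_def keep_def prod.case if_False)
      then show ?thesis
        by (simp add: T\<^sub>5_def)
    qed
  qed
  moreover have "right_edge (z (i, j)) = left_edge (z (i + 1, j))" for i j
  proof -
    have "i + 1 - j = i - j + 1"
      by simp
    then show ?thesis
      using matching_edges(2)[OF x, of i j] by (simp only: z_def prod.case tile.sel)
  qed
  moreover have "upper_edge (z (i, j)) = lower_edge (z (i, j + 1))" for i j
    using matching_edges(3)[OF x, of i j] by (simp add: z_def)
  ultimately have "z \<in> wang_shift T\<^sub>5"
    by (auto simp: wang_shift_def)
  moreover have "z (i, j) = blank" if "\<not> (- 2 * n - 2 \<le> i - j \<and> i - j \<le> 2 * n + 2)" for i j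
  proof -
    from that lo(1) hi(1) have "\<not> (lo \<le> i - j \<and> i - j \<le> hi)" "\<not> (lo \<le> i - j + 1 \<and> i - j + 1 \<le> hi)"
      by linarith+
    then show ?thesis
      by (simp only: z_def keep_def prod.case if_False)
  qed
  moreover have "z (i, j) = x (i, j)" if "- n \<le> i" "i \<le> n" "- n \<le> j" "j \<le> n" for i j
    using that lo(1) hi(1) by (intro z_box) auto
  ultimately show ?thesis
    by (intro bexI[of _ z]) auto
qed

lemma independent_translates_corners:
  assumes "T\<^sub>1 \<subseteq> T"
  shows "independent_translates (wang_shift T)"
proof (rule independent_translates_wang_shift[where R = "\<lambda>n. {(i, j). - 3 * n - 1 \<le> i \<and> - 3 * n - 1 \<le> j \<and> (i \<le> n \<or> j \<le> n)}" and p = "\<lambda>n. (4 * n + 2, 4 * n + 2)"])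
  fix n :: int and x assume "0 \<le> n" "x \<in> wang_shift T"
  then show "\<exists>z\<in>wang_shift T. (\<forall>i\<in>{- n..n}. \<forall>j\<in>{- n..n}. z (i, j) = x (i, j)) \<and>
      (\<forall>q. q \<notin> {(i, j). - 3 * n - 1 \<le> i \<and> - 3 * n - 1 \<le> j \<and> (i \<le> n \<or> j \<le> n)} \<longrightarrow> z q = blank)"
    by (rule completion_by_corners[OF assms])
qed auto

lemma independent_translates_turning_right:
  assumes "T\<^sub>4 \<subseteq> T"
  shows "independent_translates (wang_shift T)"
proof (rule independent_translates_wang_shift[where R = "\<lambda>n. {(i, j). - 3 * n - 1 \<le> j \<and> j \<le> 3 * n + 1}" and p = "\<lambda>n. (0, 6 * n + 3)"])
  fix n :: int and x assume "0 \<le> n" "x \<in> wang_shift T"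
  then show "\<exists>z\<in>wang_shift T. (\<forall>i\<in>{- n..n}. \<forall>j\<in>{- n..n}. z (i, j) = x (i, j)) \<and>
      (\<forall>q. q \<notin> {(i, j). - 3 * n - 1 \<le> j \<and> j \<le> 3 * n + 1} \<longrightarrow> z q = blank)"
    by (rule completion_by_turning_right[OF assms])
qed auto

lemma independent_translates_T2: "independent_translates (wang_shift T\<^sub>2)"
proof (rule independent_translates_wang_shift[where R = "\<lambda>n. {(i, j). - n - 1 \<le> j \<and> j \<le> n + 1}" and p = "\<lambda>n. (0, 2 * n + 3)"])
  fix n :: int and x assume "0 \<le> n" "x \<in> wang_shift T\<^sub>2"
  then show "\<exists>z\<in>wang_shift T\<^sub>2. (\<forall>i\<in>{- n..n}. \<forall>j\<in>{- n..n}. z (i, j) = x (i, j)) \<and>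
      (\<forall>q. q \<notin> {(i, j). - n - 1 \<le> j \<and> j \<le> n + 1} \<longrightarrow> z q = blank)"
    by (rule completion_T2)
qed auto

lemma independent_translates_T5: "independent_translates (wang_shift T\<^sub>5)"
proof (rule independent_translates_wang_shift[where R = "\<lambda>n. {(i, j). - 2 * n - 2 \<le> i - j \<and> i - j \<le> 2 * n + 2}" and p = "\<lambda>n. (4 * n + 5, 0)"])
  fix n :: int and x assume "0 \<le> n" "x \<in> wang_shift T\<^sub>5"
  then show "\<exists>z\<in>wang_shift T\<^sub>5. (\<forall>i\<in>{- n..n}. \<forall>j\<in>{- n..n}. z (i, j) = x (i, j)) \<and>
      (\<forall>q. q \<notin> {(i, j). - 2 * n - 2 \<le> i - j \<and> i - j \<le> 2 * n + 2} \<longrightarrow> z q = blank)"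
    by (rule completion_T5)
qed auto

section \<open>Factor maps onto single switches\<close>

lemma constant_in_wang_shift:
  assumes "t \<in> T" "left_edge t = right_edge t" "upper_edge t = lower_edge t"
  shows "(\<lambda>_. t) \<in> wang_shift T"
  using assms by (simp add: wang_shift_def)

lemma row_factor_Zbar:
  assumes fin: "finite T" and T: "\<forall>t\<in>T. left_edge t = 1 \<longrightarrow> right_edge t = 1"
    and tiles: "blank \<in> T" "Tile 1 0 1 0 \<in> T"
    and start: "\<exists>x\<in>wang_shift T. \<forall>i. left_edge (x (i, 0)) = 1 \<longleftrightarrow> i > 0"
  shows "weak_factor UNIV Zbar T (wang_shift T)"
proof (rule weak_factor_Zbar_if_monotone_symbol[where h = left_edge and \<phi> = "\<lambda>k. (k, 0)"])
  show "Modules.additive (\<lambda>k::int. (k, 0::int))"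
    by (simp add: Modules.additive_def)
  show "\<exists>x\<in>wang_shift T. \<forall>k. left_edge (x (k, 0)) = 0"
    using constant_in_wang_shift[OF tiles(1)] by (intro bexI[of _ "\<lambda>_. blank"]) simp_all
  show "\<exists>x\<in>wang_shift T. \<forall>k. left_edge (x (k, 0)) = 1"
    using constant_in_wang_shift[OF tiles(2)] by (intro bexI[of _ "\<lambda>_. Tile 1 0 1 0"]) simp_all
  fix x assume "x \<in> wang_shift T" "left_edge (x 0) = 1"
  then show "left_edge (x (1, 0)) = 1"
    using black_rows_extend_right[OF _ T, of x 0 0 1] by (simp add: zero_prod_def)
qed (use subshift_wang_shift[OF fin] start in simp_all)

text \<open>One corner with its two rays.\<close>

lemma row_start_corner:
  assumes "T\<^sub>1 \<subseteq> T"
  shows "\<exists>x\<in>wang_shift T. \<forall>i. left_edge (x (i, 0)) = 1 \<longleftrightarrow> i > 0"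
proof (rule bexI)
  let ?x = "edge_conf (\<lambda>i j. j = 0 \<and> i > 0) (\<lambda>i j. i = 0 \<and> j > 0)"
  show "\<forall>i. left_edge (?x (i, 0)) = 1 \<longleftrightarrow> i > 0"
    by (simp add: edge_conf_def)
  have "?x (i, j) \<in> T\<^sub>1" for i j
    by (cases i "0 :: int" rule: linorder_cases; cases j "0 :: int" rule: linorder_cases)
      (simp_all add: edge_conf_def T\<^sub>1_def)
  then show "?x \<in> wang_shift T"
    using assms by (intro edge_conf_in_wang_shift) blast
qed

text \<open>Two rays to the right in adjacent rows, joined by a vertical edge at their starting points.\<close>

lemma row_start_T2: "\<exists>x\<in>wang_shift T\<^sub>2. \<forall>i. left_edge (x (i, 0)) = 1 \<longleftrightarrow> i > 0"
proof (rule bexI)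
  let ?x = "edge_conf (\<lambda>i j. (j = 0 \<or> j = 1) \<and> i > 0) (\<lambda>i j. i = 0 \<and> j = 1)"
  show "\<forall>i. left_edge (?x (i, 0)) = 1 \<longleftrightarrow> i > 0"
    by (simp add: edge_conf_def)
  have "?x (i, j) \<in> T\<^sub>2" for i j
    by (cases i "0 :: int" rule: linorder_cases; cases "j = 0"; cases "j = 1")
      (simp_all add: edge_conf_def T\<^sub>2_def)
  then show "?x \<in> wang_shift T\<^sub>2"
    by (intro edge_conf_in_wang_shift)
qed

lemma diagonal_factor_T5: "weak_factor UNIV Zbar T\<^sub>5 (wang_shift T\<^sub>5)"
proof (rule weak_factor_Zbar_if_monotone_symbol[where h = lower_edge and \<phi> = "\<lambda>k. (k, k)"])
  show "subshift T\<^sub>5 (wang_shift T\<^sub>5)"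
    by (rule subshift_wang_shift) (simp add: T\<^sub>5_def)
  show "Modules.additive (\<lambda>k::int. (k, k))"
    by (simp add: Modules.additive_def)
  show "\<exists>x\<in>wang_shift T\<^sub>5. \<forall>k. lower_edge (x (k, k)) = 0"
    using constant_in_wang_shift[of blank T\<^sub>5] by (intro bexI[of _ "\<lambda>_. blank"]) (simp_all add: T\<^sub>5_def)
  show "\<exists>x\<in>wang_shift T\<^sub>5. \<forall>k. lower_edge (x (k, k)) = 1"
    using constant_in_wang_shift[of "Tile 1 1 1 1" T\<^sub>5]
    by (intro bexI[of _ "\<lambda>_. Tile 1 1 1 1"]) (simp_all add: T\<^sub>5_def)
  show "lower_edge (x (1, 1)) = 1" if "x \<in> wang_shift T\<^sub>5" "lower_edge (x 0) = 1" for x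
    using black_staircases_extend(1)[OF that(1), of 0 0 1] that(2) by (simp add: zero_prod_def)
  show "\<exists>x\<in>wang_shift T\<^sub>5. \<forall>k. lower_edge (x (k, k)) = 1 \<longleftrightarrow> k > 0"
  proof (rule bexI)
    \<comment> \<open>A single source, at the origin, with the two staircases that it emits.\<close>
    let ?x = "edge_conf (\<lambda>i j. i > 0 \<and> (j = i \<or> j = i - 1)) (\<lambda>i j. j > 0 \<and> (j = i \<or> j = i + 1))"
    show "\<forall>k. lower_edge (?x (k, k)) = 1 \<longleftrightarrow> k > 0"
      by (simp add: edge_conf_def)
    have "?x (i, j) \<in> T\<^sub>5" for i j
    proof -
      consider "j = i" "i < 0" | "j = i" "i = 0" | "j = i" "i > 0" | "j = i - 1" "i > 0" | "j = i - 1" "i \<le> 0"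
        | "j = i + 1" "i \<ge> 0" | "j = i + 1" "i < 0" | "j \<noteq> i" "j \<noteq> i - 1" "j \<noteq> i + 1"
        by linarith
      then show ?thesis
        by cases (auto simp: edge_conf_def T\<^sub>5_def)
    qed
    then show "?x \<in> wang_shift T\<^sub>5"
      by (intro edge_conf_in_wang_shift)
  qed
qed

section \<open>The seventh tileset\<close>

definition walk :: "(int \<Rightarrow> int) \<Rightarrow> bool" where
  "walk u \<longleftrightarrow> (\<forall>j. \<bar>u j - u (j - 1)\<bar> = 1)"

text \<open>The boundary between rows \<open>j\<close> and \<open>j + 1\<close> is white up to column \<open>u j\<close> and black to the right of
  it. So the black line of row \<open>j\<close> starts at the larger one of \<open>u (j - 1)\<close> and \<open>u j\<close>, with the tile
  \<open>0011\<close> if the walk steps up and \<open>0110\<close> if it steps down.\<close>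

definition walk_conf :: "(int \<Rightarrow> int) \<Rightarrow> int \<times> int \<Rightarrow> tile" where
  "walk_conf u = edge_conf (\<lambda>i j. max (u (j - 1)) (u j) < i) (\<lambda>i j. u (j - 1) < i)"

lemma walk_conf_in_wang_shift:
  assumes "walk u"
  shows "walk_conf u \<in> wang_shift T\<^sub>7"
  unfolding walk_conf_def
proof (rule edge_conf_in_wang_shift)
  fix i j
  have "u j = u (j - 1) + 1 \<or> u j = u (j - 1) - 1"
    using assms[unfolded walk_def, rule_format, of j] by linarith
  then show "edge_conf (\<lambda>i j. max (u (j - 1)) (u j) < i) (\<lambda>i j. u (j - 1) < i) (i, j) \<in> T\<^sub>7"
  proof
    assume "u j = u (j - 1) + 1"
    then show ?thesis
      by (cases i "u (j - 1) + 1" rule: linorder_cases) (simp_all add: edge_conf_def T\<^sub>7_def)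
  next
    assume "u j = u (j - 1) - 1"
    then show ?thesis
      by (cases i "u (j - 1)" rule: linorder_cases) (simp_all add: edge_conf_def T\<^sub>7_def)
  qed
qed

text \<open>Above the row \<open>J\<close>, where the cylinder has ended, let the walk go up for \<open>k\<close> steps and then down.
  In row \<open>J + m\<close> the line then starts at \<open>col k\<close>, so that the cells \<open>col 0, col 1, \<dots>\<close> of this row
  distinguish the walks.\<close>

lemma wang_shift_T7_not_class_L1: "wang_shift T\<^sub>7 \<notin> class_L1 T\<^sub>7 UNIV"
proof (rule not_class_L1_if_chains[where Y = "walk_conf ` Collect walk" and c = 1])
  show "walk_conf ` Collect walk \<subseteq> wang_shift T\<^sub>7"
    using walk_conf_in_wang_shift by blast
  have "walk (\<lambda>j. j)"
    by (simp add: walk_def)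
  then show "walk_conf ` Collect walk \<noteq> {}"
    by blast
  fix y and D :: "(int \<times> int) set" and m :: nat
  assume "y \<in> walk_conf ` Collect walk" and D: "finite D"
  then obtain u where u: "walk u" and y: "y = walk_conf u"
    by blast
  define J where "J = Max (insert 0 (snd ` D))"
  have J: "j \<le> J" if "(i, j) \<in> D" for i j
    unfolding J_def using D that by (intro Max_ge) force+
  define col where "col k = u J + 2 * int k - int m + 1" for k
  define P where "P k x \<longleftrightarrow> left_edge (x (col k, J + int m)) = 1" for k and x :: "int \<times> int \<Rightarrow> tile"
  have "\<forall>k. \<exists>W. finite W \<and> W \<subseteq> UNIV \<and> card W \<le> 1 \<and>
             (\<forall>x\<in>wang_shift T\<^sub>7. \<forall>x'\<in>wang_shift T\<^sub>7. (\<forall>q\<in>W. x q = x' q) \<longrightarrow> P k x = P k x')"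
  proof
    fix k
    show "\<exists>W. finite W \<and> W \<subseteq> UNIV \<and> card W \<le> 1 \<and>
             (\<forall>x\<in>wang_shift T\<^sub>7. \<forall>x'\<in>wang_shift T\<^sub>7. (\<forall>q\<in>W. x q = x' q) \<longrightarrow> P k x = P k x')"
      by (intro exI[of _ "{(col k, J + int m)}"]) (simp add: P_def)
  qed
  moreover have "\<forall>k. \<forall>x\<in>wang_shift T\<^sub>7. P k x \<longrightarrow> P (Suc k) x"
  proof (intro allI ballI impI)
    fix k x assume x: "x \<in> wang_shift T\<^sub>7" and "P k x"
    have "\<forall>t\<in>T\<^sub>7. left_edge t = 1 \<longrightarrow> right_edge t = 1"
      by (simp add: T\<^sub>7_def)
    from black_rows_extend_right[OF x this, of "col k" "J + int m" "col (Suc k)"] \<open>P k x\<close>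
    show "P (Suc k) x"
      by (simp add: P_def col_def)
  qed
  moreover have "\<forall>k<m. \<exists>z\<in>walk_conf ` Collect walk. (\<forall>q\<in>D. z q = y q) \<and> \<not> P k z \<and> P (Suc k) z"
  proof (intro allI impI)
    fix k assume k: "k < m"
    define v where "v j = (if j \<le> J then u j else u J + (int k - \<bar>j - J - int k\<bar>))" for j
    have v: "\<bar>v j - v (j - 1)\<bar> = 1" for j
    proof (cases "j \<le> J")
      case True
      then show ?thesis
        using u[unfolded walk_def, rule_format, of j] by (simp add: v_def)
    next
      case False
      have "v (j - 1) = u J + (int k - \<bar>j - 1 - J - int k\<bar>)"
        using False by (cases "j = J + 1") (simp_all add: v_def)
      moreover have "v j = u J + (int k - \<bar>j - J - int k\<bar>)"
        using False by (simp add: v_def)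
      ultimately show ?thesis
        by linarith
    qed
    have v_end: "max (v (J + int m - 1)) (v (J + int m)) = col k"
    proof -
      have "v (J + int m - 1) = u J + (int k - \<bar>int m - 1 - int k\<bar>)"
        using k by (cases "m = 1") (simp_all add: v_def)
      moreover have "v (J + int m) = u J + (int k - \<bar>int m - int k\<bar>)"
        using k by (simp add: v_def)
      ultimately show ?thesis
        using k by (simp add: col_def)
    qed
    show "\<exists>z\<in>walk_conf ` Collect walk. (\<forall>q\<in>D. z q = y q) \<and> \<not> P k z \<and> P (Suc k) z"
    proof (rule bexI[of _ "walk_conf v"], intro conjI ballI)
      show "walk_conf v \<in> walk_conf ` Collect walk"
        using v by (simp add: walk_def)
      show "\<not> P k (walk_conf v)" "P (Suc k) (walk_conf v)"
        unfolding P_def walk_conf_def edge_conf_def prod.case tile.sel v_end by (simp_all add: col_def)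
      fix q assume "q \<in> D"
      then show "walk_conf v q = y q"
        using J by (cases q) (force simp: y walk_conf_def edge_conf_def v_def)
    qed
  qed
  ultimately show "\<exists>P. (\<forall>k. \<exists>W. finite W \<and> W \<subseteq> UNIV \<and> card W \<le> 1 \<and>
             (\<forall>x\<in>wang_shift T\<^sub>7. \<forall>x'\<in>wang_shift T\<^sub>7. (\<forall>q\<in>W. x q = x' q) \<longrightarrow> P k x = P k x')) \<and>
        (\<forall>k. \<forall>x\<in>wang_shift T\<^sub>7. P k x \<longrightarrow> P (Suc k) x) \<and>
        (\<forall>k<m. \<exists>z\<in>walk_conf ` Collect walk. (\<forall>q\<in>D. z q = y q) \<and> \<not> P k z \<and> P (Suc k) z)"
    by (intro exI[of _ P] conjI)
qed

theorem theorem4p2: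
  shows "(\<forall>T\<in>{T\<^sub>1, T\<^sub>2, T\<^sub>3, T\<^sub>4, T\<^sub>5, T\<^sub>6}.
            weakly_mixing (wang_shift T) \<and>
            weak_factor UNIV Zbar T (wang_shift T) \<and>
            wang_shift T \<notin> class_L1 T UNIV) \<and>
         wang_shift T\<^sub>7 \<notin> class_L1 T\<^sub>7 UNIV"
proof -
  note defs = T\<^sub>1_def T\<^sub>2_def T\<^sub>3_def T\<^sub>4_def T\<^sub>6_def
  have corner: "independent_translates (wang_shift T) \<and> weak_factor UNIV Zbar T (wang_shift T)"
    if "T \<in> {T\<^sub>1, T\<^sub>3}" for T
  proof
    have sub: "T\<^sub>1 \<subseteq> T"
      using that by (auto simp: defs)
    show "independent_translates (wang_shift T)"
      by (rule independent_translates_corners[OF sub])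
    show "weak_factor UNIV Zbar T (wang_shift T)"
      by (rule row_factor_Zbar[OF _ _ _ _ row_start_corner[OF sub]]) (use that in \<open>auto simp: defs\<close>)
  qed
  have turning: "independent_translates (wang_shift T) \<and> weak_factor UNIV Zbar T (wang_shift T)"
    if "T \<in> {T\<^sub>4, T\<^sub>6}" for T
  proof
    have sub: "T\<^sub>1 \<subseteq> T" "T\<^sub>4 \<subseteq> T"
      using that by (auto simp: defs)
    show "independent_translates (wang_shift T)"
      by (rule independent_translates_turning_right[OF sub(2)])
    show "weak_factor UNIV Zbar T (wang_shift T)"
      by (rule row_factor_Zbar[OF _ _ _ _ row_start_corner[OF sub(1)]]) (use that in \<open>auto simp: defs\<close>)
  qed
  have "weak_factor UNIV Zbar T\<^sub>2 (wang_shift T\<^sub>2)"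
    by (rule row_factor_Zbar[OF _ _ _ _ row_start_T2]) (auto simp: defs)
  then have main: "independent_translates (wang_shift T) \<and> weak_factor UNIV Zbar T (wang_shift T)"
    if "T \<in> {T\<^sub>1, T\<^sub>2, T\<^sub>3, T\<^sub>4, T\<^sub>5, T\<^sub>6}" for T
    using that corner turning independent_translates_T2 independent_translates_T5 diagonal_factor_T5 by blast
  have "weakly_mixing (wang_shift T) \<and> weak_factor UNIV Zbar T (wang_shift T) \<and>
      wang_shift T \<notin> class_L1 T UNIV" if "T \<in> {T\<^sub>1, T\<^sub>2, T\<^sub>3, T\<^sub>4, T\<^sub>5, T\<^sub>6}" for T
  proof -
    have ind: "independent_translates (wang_shift T)" and wf: "weak_factor UNIV Zbar T (wang_shift T)"
      using main[OF that] by blast+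
    show ?thesis
      using weakly_mixing_if_independent_translates[OF shift_wang_shift ind] wf
        not_class_L1_if_weak_factor_Zbar[OF ind wf] by blast
  qed
  then show ?thesis
    using wang_shift_T7_not_class_L1 by blast
qed

end
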